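(* Let $\{e_1,\ldots,e_d\}$ be a finite symmetric (i.e. stable under inversion) set of generators of a group, and let $G$ be the associated Cayley graph. Let $(\alpha_1,\ldots,\alpha_d)$ be positive reals. If the simple random walk on the Cayley graph is transient, then for almost every environment the random walk in Dirichlet environment on the Cayley graph $G$, with weights $\alpha_{(g,ge_i)}=\alpha_i$ for every group element $g$ and every $i=1,\dots,d$, is transient.
   Context: The Cayley graph is viewed as the directed graph whose vertices are the group elements and whose edges are the pairs $(g,ge_i)$, for $g$ in the group and $i=1,\dots,d$. Dirichlet law: for $\alpha_1,\dots,\alpha_N>0$, the Dirichlet law with these parameters is the law on $\{p\in[0,1]^N:\sum p_i=1\}$ with density $\frac{\Gamma(\sum\alpha_i)}{\prod\Gamma(\alpha_i)}\prod p_i^{\alpha_i-1}$ with respect to $dp_1\cdots dp_{N-1}$ (point mass at $1$ if $N=1$). The random walk in Dirichlet environment on $G$ with the given weights is defined as follows: the environment is a random family of transition probabilities $(p_{(g,ge_i)})_{g,\,i}$ such that the vectors $(p_{(g,ge_i)})_{i=1,\dots,d}$, for $g$ in the group, are independent, each with the Dirichlet law with parameters $(\alpha_1,\dots,\alpha_d)$; given the environment, the walk is the Markov chain on the group that jumps from $g$ to $ge_i$ with probability $p_{(g,ge_i)}$. *)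

theory Defs
  imports "HOL-Probability.Probability" "HOL-Algebra.Generated_Groups"
begin

text \<open>
  Law on the space of trajectories of the Markov chain with transition kernel \<open>K\<close> started
  at \<open>x\<close>, by the Ionescu-Tulcea construction. Its finite-dimensional distributions are
  computed in \<open>emeasure_markov_law_cylinder\<close> below.
\<close>

definition markov_step :: "('a \<Rightarrow> 'a pmf) \<Rightarrow> 'a \<Rightarrow> nat \<Rightarrow> (nat \<Rightarrow> 'a) \<Rightarrow> 'a measure" where
  "markov_step K x n \<omega> = measure_pmf (case n of 0 \<Rightarrow> return_pmf x | Suc m \<Rightarrow> K (\<omega> m))"

global_interpretation markov: Ionescu_Tulcea "markov_step K x" "\<lambda>_. count_space UNIV" for K x
proof (rule Ionescu_Tulcea.intro)
  fix n
  show "markov_step K x n \<in> PiM {0..<n} (\<lambda>_. count_space UNIV) \<rightarrow>\<^sub>M subprob_algebra (count_space UNIV)"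
  proof (cases n)
    case (Suc m)
    have "(\<lambda>y. measure_pmf (K y)) \<in> count_space UNIV \<rightarrow>\<^sub>M subprob_algebra (count_space UNIV)"
      by (auto simp: space_subprob_algebra measure_pmf.subprob_space_axioms)
    moreover have "(\<lambda>\<omega>. \<omega> m) \<in> PiM {0..<n} (\<lambda>_. count_space UNIV) \<rightarrow>\<^sub>M count_space UNIV"
      using Suc by (intro measurable_component_singleton) auto
    ultimately show ?thesis
      using measurable_compose Suc by (auto simp: markov_step_def[abs_def])
  qed (auto simp: markov_step_def[abs_def] space_subprob_algebra measure_pmf.subprob_space_axioms)
qed (simp add: markov_step_def prob_space_measure_pmf)

definition markov_law :: "('a \<Rightarrow> 'a pmf) \<Rightarrow> 'a \<Rightarrow> (nat \<Rightarrow> 'a) measure" where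
  "markov_law K x = markov.PF.lim K x"

lemma sets_markov_law: "sets (markov_law K x) = sets (PiM UNIV (\<lambda>_. count_space UNIV))"
  unfolding markov_law_def by (rule markov.PF.sets_lim)

lemma space_markov_law: "space (markov_law K x) = UNIV"
  unfolding markov_law_def by (simp add: markov.PF.space_lim space_PiM)

lemma emeasure_markov_law_cylinder:
  "emeasure (markov_law K x) {\<omega>. \<forall>i\<le>n. \<omega> i = s i} =
     (if s 0 = x then \<Prod>i<n. ennreal (pmf (K (s i)) (s (Suc i))) else 0)"
proof -
  let ?M = "\<lambda>_::nat. count_space (UNIV :: 'a set)"
  let ?S = "\<lambda>k. PiE {0..<k} (\<lambda>i. {s i})"
  define q where "q n = emeasure (markov_step K x n s) {s n}" for n
  have S[measurable]: "?S k \<in> sets (PiM {0..<k} ?M)" for k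
    by (intro sets_PiM_I_finite) auto
  have step: "emeasure (markov.eP K x k \<omega>) (?S (Suc k)) = q k * indicator (?S k) \<omega>"
    if "\<omega> \<in> space (PiM {0..<k} ?M)" for k \<omega>
  proof -
    have upd: "fun_upd \<omega> k y \<in> ?S (Suc k) \<longleftrightarrow> \<omega> \<in> ?S k \<and> y = s k" for y
      using that by (auto simp: space_PiM PiE_iff extensional_def)
    have "emeasure (markov.eP K x k \<omega>) (?S (Suc k)) =
        emeasure (markov_step K x k \<omega>) {y. \<omega> \<in> ?S k \<and> y = s k}"
      by (subst markov.emeasure_eP[OF that S]) (simp add: upd vimage_def)
    also have "\<dots> = q k * indicator (?S k) \<omega>"
    proof (cases "\<omega> \<in> ?S k")
      case True
      then have "markov_step K x k \<omega> = markov_step K x k s"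
        by (cases k) (auto simp: markov_step_def PiE_iff)
      with True show ?thesis
        by (simp add: q_def)
    qed (simp add: emeasure_empty)
    finally show ?thesis .
  qed
  have C: "emeasure (markov.C K x 0 k (\<lambda>_. undefined)) (?S k) = (\<Prod>i<k. q i)" for k
  proof (induction k)
    case 0
    then show ?case
      using S[of 0] by (simp add: emeasure_return)
  next
    case (Suc k)
    let ?C = "markov.C K x 0 k (\<lambda>_. undefined)"
    have sp: "space ?C = space (PiM {0..<k} ?M)"
      by (subst markov.space_C) (auto simp: space_PiM)
    have st: "sets ?C = sets (PiM {0..<k} ?M)"
      by (subst markov.sets_C) (auto simp: space_PiM)
    have "emeasure (markov.C K x 0 (Suc k) (\<lambda>_. undefined)) (?S (Suc k)) =
        (\<integral>\<^sup>+\<omega>. emeasure (markov.eP K x k \<omega>) (?S (Suc k)) \<partial>?C)"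
      using emeasure_bind[where M="?C" and f="markov.eP K x k" and X="?S (Suc k)"
          and N="PiM {0..<Suc k} ?M"] markov.measurable_eP[of K x k] S[of "Suc k"]
      by (simp add: sp measurable_cong_sets[OF st refl])
    also have "\<dots> = (\<integral>\<^sup>+\<omega>. q k * indicator (?S k) \<omega> \<partial>?C)"
      by (intro nn_integral_cong step) (simp add: sp)
    also have "\<dots> = q k * emeasure ?C (?S k)"
      using S[of k] by (intro nn_integral_cmult_indicator) (simp add: st)
    finally show ?case
      by (simp add: Suc.IH mult.commute)
  qed
  have "{\<omega>. \<forall>i\<le>n. \<omega> i = s i} = prod_emb UNIV ?M {0..<Suc n} (?S (Suc n))"
    by (auto simp: prod_emb_def space_PiM PiE_iff)
  then have "emeasure (markov_law K x) {\<omega>. \<forall>i\<le>n. \<omega> i = s i} = (\<Prod>i<Suc n. q i)"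
    unfolding markov_law_def using markov.lim[where K=K and x=x and J="{0..<Suc n}" and X="?S (Suc n)"] S[of "Suc n"]
      markov.emeasure_CI[where K=K and x=x and J="{0..<Suc n}" and n="Suc n" and X="?S (Suc n)"] C[of "Suc n"]
    by (simp add: prod_emb_id sets.sets_into_space)
  also have "\<dots> = q 0 * (\<Prod>i<n. q (Suc i))"
    by (rule prod.lessThan_Suc_shift)
  also have "\<dots> = (if s 0 = x then \<Prod>i<n. ennreal (pmf (K (s i)) (s (Suc i))) else 0)"
    by (simp add: q_def markov_step_def emeasure_pmf_single)
  finally show ?thesis .
qed

lemma prob_space_markov_law: "prob_space (markov_law K x)"
proof
  let ?M = "\<lambda>_::nat. count_space (UNIV :: 'a set)"
  have "emeasure (markov.PF.lim K x) (prod_emb UNIV ?M {} (space (PiM {} ?M))) =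
      emeasure (markov.CI K x {}) (space (PiM {} ?M))"
    by (rule markov.lim) auto
  also have "\<dots> = 1"
    using prob_space.emeasure_space_1[OF markov.PF.prob_space_P[where K=K and x=x and J="{}"]]
    by (simp add: markov.PF.space_P)
  also have "prod_emb UNIV ?M {} (space (PiM {} ?M)) = space (markov_law K x)"
    by (auto simp: prod_emb_def space_PiM space_markov_law)
  finally show "emeasure (markov_law K x) (space (markov_law K x)) = 1"
    by (simp add: markov_law_def)
qed

lemma sets_markov_law_hits: "{\<omega>. \<exists>n\<ge>k. \<omega> n = y} \<in> sets (markov_law K x)"
proof -
  have "(\<lambda>\<omega>. \<omega> n) -` {y} \<inter> space (PiM UNIV (\<lambda>_. count_space UNIV)) \<in>
      sets (PiM UNIV (\<lambda>_::nat. count_space (UNIV :: 'a set)))" for n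
    by (rule measurable_sets[OF measurable_component_singleton]) auto
  then have "(\<Union>n\<in>{k..}. {\<omega>. \<omega> n = y}) \<in> sets (markov_law K x)"
    by (intro sets.countable_UN'') (auto simp: sets_markov_law space_PiM vimage_def)
  also have "(\<Union>n\<in>{k..}. {\<omega>. \<omega> n = y}) = {\<omega>. \<exists>n\<ge>k. \<omega> n = y}"
    by auto
  finally show ?thesis .
qed

definition transient :: "'a set \<Rightarrow> ('a \<Rightarrow> 'a pmf) \<Rightarrow> bool" where
  "transient V K \<longleftrightarrow> (\<forall>x\<in>V. measure (markov_law K x) {\<omega>. \<exists>n\<ge>1. \<omega> n = x} < 1)"

text \<open>
  The Dirichlet law on functions on \<open>{1..N}\<close>: the density is with respect to the first
  \<open>N - 1\<close> coordinates, the last one being determined by them. For \<open>N = 1\<close> the base measure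
  is the unit mass of the one-point space, so the law is the point mass at \<open>1\<close>.
\<close>

definition dirichlet_density :: "nat \<Rightarrow> (nat \<Rightarrow> real) \<Rightarrow> (nat \<Rightarrow> real) \<Rightarrow> real" where
  "dirichlet_density N \<alpha> p =
     (if (\<forall>i\<in>{1..N}. 0 \<le> p i) \<and> (\<Sum>i=1..N. p i) = 1
      then Gamma (\<Sum>i=1..N. \<alpha> i) / (\<Prod>i=1..N. Gamma (\<alpha> i)) * (\<Prod>i=1..N. p i powr (\<alpha> i - 1))
      else 0)"

definition dirichlet :: "nat \<Rightarrow> (nat \<Rightarrow> real) \<Rightarrow> (nat \<Rightarrow> real) measure" where
  "dirichlet N \<alpha> =
     (let complete = (\<lambda>p. p(N := 1 - (\<Sum>i\<in>{1..<N}. p i)))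
      in distr (density (PiM {1..<N} (\<lambda>_. lborel)) (\<lambda>p. ennreal (dirichlet_density N \<alpha> (complete p))))
           (PiM {1..N} (\<lambda>_. borel)) complete)"

definition cayley_edges :: "('a, 'b) monoid_scheme \<Rightarrow> 'a set \<Rightarrow> ('a \<times> 'a) set" where
  "cayley_edges G S = {(g, g \<otimes>\<^bsub>G\<^esub> s) | g s. g \<in> carrier G \<and> s \<in> S}"

definition simple_walk :: "('a \<times> 'a) set \<Rightarrow> 'a \<Rightarrow> 'a pmf" where
  "simple_walk E x = pmf_of_set (E `` {x})"

text \<open>
  An environment is a function \<open>p\<close> with \<open>p g i\<close> the probability of the jump from \<open>g\<close> along
  its edge \<open>(g, g e\<^sub>i)\<close>. The kernel below is meaningful when every \<open>p g\<close> is a probability vector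
  on \<open>{1..d}\<close>, which holds for almost every Dirichlet environment.
\<close>

definition env_walk ::
    "('a, 'b) monoid_scheme \<Rightarrow> nat \<Rightarrow> (nat \<Rightarrow> 'a) \<Rightarrow> ('a \<Rightarrow> nat \<Rightarrow> real) \<Rightarrow> 'a \<Rightarrow> 'a pmf" where
  "env_walk G d e p g =
     map_pmf (\<lambda>i. g \<otimes>\<^bsub>G\<^esub> e i) (embed_pmf (\<lambda>i. if i \<in> {1..d} then p g i else 0))"

definition dirichlet_env ::
    "('a, 'b) monoid_scheme \<Rightarrow> nat \<Rightarrow> (nat \<Rightarrow> real) \<Rightarrow> ('a \<Rightarrow> nat \<Rightarrow> real) measure" where
  "dirichlet_env G d \<alpha> = PiM (carrier G) (\<lambda>_. dirichlet d \<alpha>)"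

end

theory Submission
  imports Defs
begin

text \<open>
  The argument is Sabot's. Fix a vertex \<open>z\<close> and let \<open>W\<^sub>k\<close> be the quenched probability of at least
  \<open>k\<close> returns to \<open>z\<close>. If the walk in the environment \<open>p\<close> returns almost surely, then \<open>W\<^sub>k = 1\<close>
  for every \<open>k\<close> (\<open>visit_tendsto_1\<close>), so it suffices that the mean of \<open>W\<^sub>k\<close> over the environments
  tends to \<open>0\<close>.

  Time reversal makes this mean computable for suitable weights. The expectation of the probability
  of a trail under Dirichlet weights is a product of Polya urn factors, which depends only on how
  often each edge is used and how often each vertex is left. A closed trail leaves every vertex as
  often as it enters it, so if at every vertex the weights of the outgoing edges and those of the
  incoming edges have the same sum, then the same number is the probability that an
  edge-reinforced walk follows the trail backwards. Now let the outgoing sum at \<open>z\<close> exceed the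
  incoming sum by \<open>\<gamma> > 0\<close>, with equality elsewhere. The reversed reinforced walk then dies with
  probability \<open>\<gamma> / (b z + j)\<close> when it leaves \<open>z\<close> after \<open>j\<close> previous departures, where \<open>b z\<close> is the
  outgoing sum at \<open>z\<close>. Hence at least \<open>k\<close> returns have a mean probability of at most
  \<open>\<Prod>j<k. 1 - \<gamma> / (b z + j)\<close> (\<open>sum_urn_weight_le\<close>), and this tends to \<open>0\<close>.

  The given weights \<open>\<alpha>\<close> are balanced at every vertex, so they have to be perturbed to
  \<open>\<alpha> + \<delta>\<close> with a flow \<open>\<delta>\<close> of strength \<open>\<gamma>\<close> from \<open>z\<close> to infinity. By the Cauchy-Schwarz
  inequality, the price of the perturbation is a factor \<open>E[p\<^bsup>\<delta>\<^esup>] E[p\<^bsup>-\<delta>\<^esup>]\<close>, a product of quotients of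
  Gamma functions in which the terms of first order in \<open>\<delta>\<close> cancel, so that it is at most the
  exponential of a multiple of \<open>\<Sum>\<delta>\<^sup>2\<close> (\<open>dirichlet_moment_symmetric_le\<close>). Transience of the simple
  random walk is used exactly here: it provides a flow of finite energy, namely the positive part of
  the gradient of the probability of hitting \<open>z\<close> (\<open>finite_energy_flow\<close>).
  The resulting bound \<open>nn_integral_visit_squared_le\<close> is uniform in the time horizon.
\<close>

section \<open>Symmetric products of the Gamma function\<close>

text \<open>
  The second derivative of \<open>ln_Gamma\<close> is the decreasing function \<open>Polygamma 1\<close>, and all points of
  \<open>[a - t, a + t]\<close> are at least \<open>a / 2\<close>.
\<close>

lemma ln_Gamma_second_difference_le:
  fixes a t :: real
  assumes a: "a > 0" and t: "0 \<le> t" "t \<le> a / 2"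
  shows "ln_Gamma (a + t) + ln_Gamma (a - t) - 2 * ln_Gamma a \<le> Polygamma 1 (a / 2) * t\<^sup>2"
proof -
  define C where "C = Polygamma 1 (a / 2)"
  define \<phi> where "\<phi> = (\<lambda>t. ln_Gamma (a + t) + ln_Gamma (a - t) - C * t\<^sup>2)"
  have "\<phi> t \<le> \<phi> 0"
  proof (rule DERIV_nonpos_imp_nonincreasing[OF t(1)])
    fix x assume x: "0 \<le> x" "x \<le> t"
    have 1: "(\<phi> has_real_derivative (Digamma (a + x) - Digamma (a - x) - C * (2 * x))) (at x)"
      unfolding \<phi>_def using a t x by (auto intro!: derivative_eq_intros)
    have "Digamma (a + x) - Digamma (a - x) \<le> C * (2 * x)"
    proof (cases "x = 0")
      case False
      have "\<exists>\<xi>. a - x < \<xi> \<and> \<xi> < a + x \<and>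
          Digamma (a + x) - Digamma (a - x) = ((a + x) - (a - x)) * Polygamma (Suc 0) \<xi>"
        using False a t x
        by (intro MVT2 derivative_intros impI allI) (auto elim!: nonpos_Ints_cases)
      then obtain \<xi> where \<xi>: "a - x < \<xi>"
        "Digamma (a + x) - Digamma (a - x) = 2 * x * Polygamma 1 \<xi>" by auto
      have "Polygamma 1 \<xi> < C"
        unfolding C_def using \<xi>(1) a t x by (intro Polygamma_real_strict_antimono) auto
      then have "2 * x * Polygamma 1 \<xi> \<le> 2 * x * C"
        using x by (intro mult_left_mono) auto
      then show ?thesis unfolding \<xi>(2) by (simp add: mult_ac)
    qed simp
    with 1 show "\<exists>y. DERIV \<phi> x :> y \<and> y \<le> 0" by fastforce
  qed
  then show ?thesis by (simp add: \<phi>_def C_def)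
qed

lemma Gamma_symmetric_product_le:
  fixes a t :: real
  assumes a: "a > 0" and t: "0 \<le> t" "t \<le> a / 2"
  shows "Gamma (a + t) * Gamma (a - t) \<le> exp (Polygamma 1 (a / 2) * t\<^sup>2) * (Gamma a)\<^sup>2"
proof -
  have p: "a + t > 0" "a - t > 0" using a t by auto
  have "Gamma (a + t) * Gamma (a - t) = exp (ln_Gamma (a + t) + ln_Gamma (a - t))"
    unfolding Gamma_real_pos_exp[OF p(1)] Gamma_real_pos_exp[OF p(2)] exp_add ..
  also have "\<dots> \<le> exp (Polygamma 1 (a / 2) * t\<^sup>2 + 2 * ln_Gamma a)"
    using ln_Gamma_second_difference_le[OF assms] by simp
  also have "\<dots> = exp (Polygamma 1 (a / 2) * t\<^sup>2) * (Gamma a)\<^sup>2"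
    unfolding Gamma_real_pos_exp[OF a] exp_add mult_2 power2_eq_square[of "exp _"] ..
  finally show ?thesis .
qed

text \<open>
  Logarithmic convexity of the Gamma function at the midpoint of \<open>a + t\<close> and \<open>a - t\<close>.
\<close>

lemma Gamma_midpoint_le:
  fixes a t :: real
  assumes "\<bar>t\<bar> < a"
  shows "(Gamma a)\<^sup>2 \<le> Gamma (a + t) * Gamma (a - t)"
proof -
  have p: "a + t > 0" "a - t > 0" "a > 0" using assms by auto
  have eq: "(1 - 1 / 2) *\<^sub>R (a + t) + (1 / 2) *\<^sub>R (a - t) = a" by (simp add: field_simps)
  have "(ln \<circ> Gamma) a \<le> (1 - 1/2) * (ln \<circ> Gamma) (a + t) + (1/2) * (ln \<circ> Gamma) (a - t)"
    using convex_onD[OF log_convex_Gamma_real, of "1/2" "a + t" "a - t"] p unfolding eq by simp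
  then have "2 * ln_Gamma a \<le> ln_Gamma (a + t) + ln_Gamma (a - t)"
    using p by (simp add: ln_Gamma_real_pos field_simps)
  then have "exp (2 * ln_Gamma a) \<le> exp (ln_Gamma (a + t) + ln_Gamma (a - t))" by simp
  then show ?thesis
    unfolding Gamma_real_pos_exp[OF p(1)] Gamma_real_pos_exp[OF p(2)] Gamma_real_pos_exp[OF p(3)]
      exp_add mult_2 power2_eq_square .
qed

section \<open>The Dirichlet law and its moments\<close>

lemma nn_integral_Beta_interval:
  fixes a b t :: real
  assumes ab: "a > 0" "b > 0" and t: "t > 0"
  shows "(\<integral>\<^sup>+y. ennreal (if 0 < y \<and> y < t then y powr (a - 1) * (t - y) powr (b - 1) else 0) \<partial>lborel)
    = ennreal (Beta a b * t powr (a + b - 1))"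
proof -
  have "(\<integral>\<^sup>+y. ennreal (if 0 < y \<and> y < t then y powr (a - 1) * (t - y) powr (b - 1) else 0) \<partial>lborel)
    = ennreal t * (\<integral>\<^sup>+y. ennreal (if 0 < t * y \<and> t * y < t then (t * y) powr (a - 1) * (t - t * y) powr (b - 1) else 0) \<partial>lborel)"
    using nn_integral_real_affine[of "\<lambda>y. ennreal (if 0 < y \<and> y < t then y powr (a - 1) * (t - y) powr (b - 1) else 0)" t 0] t
    unfolding add_0 by simp
  also have "(\<integral>\<^sup>+y. ennreal (if 0 < t * y \<and> t * y < t then (t * y) powr (a - 1) * (t - t * y) powr (b - 1) else 0) \<partial>lborel)
     = (\<integral>\<^sup>+y. ennreal (t powr (a + b - 2)) * (ennreal (y powr (a - 1) * (1 - y) powr (b - 1)) * indicator {0<..<1} y) \<partial>lborel)"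
  proof (intro nn_integral_cong)
    fix y :: real
    have "(t * y) powr (a - 1) * (t - t * y) powr (b - 1) =
      t powr (a + b - 2) * (y powr (a - 1) * (1 - y) powr (b - 1))" if "0 < y" "y < 1"
    proof -
      have "(t - t * y) = t * (1 - y)" by (simp add: algebra_simps)
      then have "(t * y) powr (a - 1) * (t - t * y) powr (b - 1) =
         (t powr (a - 1) * t powr (b - 1)) * (y powr (a - 1) * (1 - y) powr (b - 1))"
        using that t by (simp add: powr_mult)
      also have "t powr (a - 1) * t powr (b - 1) = t powr (a + b - 2)"
        by (simp add: powr_add[symmetric])
      finally show ?thesis .
    qed
    then show "ennreal (if 0 < t * y \<and> t * y < t then (t * y) powr (a - 1) * (t - t * y) powr (b - 1) else 0)
       = ennreal (t powr (a + b - 2)) * (ennreal (y powr (a - 1) * (1 - y) powr (b - 1)) * indicator {0<..<1} y)"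
      using t by (auto simp: indicator_def ennreal_mult zero_less_mult_iff)
  qed
  also have "\<dots> = ennreal (t powr (a + b - 2)) * ennreal (Beta a b)"
    using nn_integral_has_integral_lebesgue'[of "{0<..<1}" "\<lambda>t. t powr (a - 1) * (1 - t) powr (b - 1)" "Beta a b"]
      has_integral_Beta_real[OF ab] by (simp add: nn_integral_cmult has_integral_Icc_iff_Ioo)
  also have "ennreal t * (ennreal (t powr (a + b - 2)) * ennreal (Beta a b)) =
      ennreal (t powr 1 * t powr (a + b - 2) * Beta a b)"
    using t by (simp add: ennreal_mult' ennreal_mult'' mult.assoc)
  also have "t powr 1 * t powr (a + b - 2) = t powr (a + b - 1)"
    by (simp only: powr_add[symmetric]) simp
  finally show ?thesis by (simp add: mult_ac)
qed

text \<open>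
  Dirichlet's integral over the open simplex. The size \<open>t\<close> and the exponent \<open>b\<close> of the slack
  variable are general because the induction integrates out one coordinate by the Beta integral over
  an interval of length \<open>t - (\<Sum>i\<in>I. x i)\<close>, which only raises the exponent of the slack.
\<close>

lemma nn_integral_simplex:
  fixes a :: "nat \<Rightarrow> real" and b t :: real
  assumes "finite I" "\<And>i. i \<in> I \<Longrightarrow> a i > 0" "b > 0" "t > 0"
  shows "(\<integral>\<^sup>+x. ennreal (if (\<forall>i\<in>I. 0 < x i) \<and> (\<Sum>i\<in>I. x i) < t
        then (\<Prod>i\<in>I. x i powr (a i - 1)) * (t - (\<Sum>i\<in>I. x i)) powr (b - 1) else 0) \<partial>PiM I (\<lambda>_. lborel))
     = ennreal ((\<Prod>i\<in>I. Gamma (a i)) * Gamma b / Gamma ((\<Sum>i\<in>I. a i) + b) * t powr ((\<Sum>i\<in>I. a i) + b - 1))"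
  using assms
proof (induction I arbitrary: b rule: finite_induct)
  case empty
  then show ?case
    using less_imp_neq[OF Gamma_real_pos[of b]] by (auto simp: PiM_empty nn_integral_count_space_finite)
next
  case (insert j I)
  interpret product_sigma_finite "\<lambda>_::nat. lborel :: real measure"
    by standard
  let ?S = "\<lambda>x. \<Sum>i\<in>I. x i" and ?P = "\<lambda>x. \<Prod>i\<in>I. x i powr (a i - 1)"
  let ?f = "\<lambda>x. ennreal (if (\<forall>i\<in>insert j I. 0 < x i) \<and> (\<Sum>i\<in>insert j I. x i) < t
        then (\<Prod>i\<in>insert j I. x i powr (a i - 1)) * (t - (\<Sum>i\<in>insert j I. x i)) powr (b - 1) else 0)"
  have aj: "a j > 0" and aI: "\<And>i. i \<in> I \<Longrightarrow> a i > 0" using insert.prems by auto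
  have [measurable]: "?f \<in> borel_measurable (PiM (insert j I) (\<lambda>_. lborel))"
    using insert.hyps(1) by measurable
  have "(\<integral>\<^sup>+x. ?f x \<partial>PiM (insert j I) (\<lambda>_. lborel)) =
      (\<integral>\<^sup>+x. \<integral>\<^sup>+y. ?f (x(j := y)) \<partial>lborel \<partial>PiM I (\<lambda>_. lborel))"
    by (rule product_nn_integral_insert) (use insert.hyps in auto)
  also have "\<dots> = (\<integral>\<^sup>+x. ennreal (Beta (a j) b) * ennreal (if (\<forall>i\<in>I. 0 < x i) \<and> ?S x < t
        then ?P x * (t - ?S x) powr ((a j + b) - 1) else 0) \<partial>PiM I (\<lambda>_. lborel))"
  proof (intro nn_integral_cong)
    fix x :: "nat \<Rightarrow> real"
    have upd: "(\<Sum>i\<in>I. if i = j then y else x i) = ?S x"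
      "(\<Prod>i\<in>I. (if i = j then y else x i) powr (a i - 1)) = ?P x"
      "(\<forall>i\<in>I. 0 < (if i = j then y else x i)) \<longleftrightarrow> (\<forall>i\<in>I. 0 < x i)" for y
      using insert.hyps(2) by (auto intro!: sum.cong prod.cong)
    have fy: "?f (x(j := y)) = (if (\<forall>i\<in>I. 0 < x i) then ennreal (?P x) else 0) *
       ennreal (if 0 < y \<and> y < t - ?S x then y powr (a j - 1) * ((t - ?S x) - y) powr (b - 1) else 0)" for y
    proof -
      have c: "y + ?S x < t \<longleftrightarrow> y < t - ?S x" by linarith
      have e: "t - (y + ?S x) = (t - ?S x) - y" by simp
      show ?thesis
        using insert.hyps by (simp add: upd c e prod_nonneg ennreal_mult mult_ac)
    qed
    have "(\<integral>\<^sup>+y. ?f (x(j := y)) \<partial>lborel) = (if (\<forall>i\<in>I. 0 < x i) then ennreal (?P x) else 0) *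
       (\<integral>\<^sup>+y. ennreal (if 0 < y \<and> y < t - ?S x then y powr (a j - 1) * ((t - ?S x) - y) powr (b - 1) else 0) \<partial>lborel)"
      unfolding fy by (rule nn_integral_cmult) measurable
    also have "\<dots> = ennreal (Beta (a j) b) * ennreal (if (\<forall>i\<in>I. 0 < x i) \<and> ?S x < t
        then ?P x * (t - ?S x) powr ((a j + b) - 1) else 0)"
    proof (cases "?S x < t")
      case True
      then show ?thesis
        using nn_integral_Beta_interval[OF aj insert.prems(2), of "t - ?S x"]
        by (auto simp: ennreal_mult'' ennreal_mult' prod_nonneg mult_ac)
    next
      case False
      then have "(\<lambda>y. ennreal (if 0 < y \<and> y < t - ?S x then y powr (a j - 1) * ((t - ?S x) - y) powr (b - 1) else 0)) = (\<lambda>_. 0)"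
        by auto
      with False show ?thesis by simp
    qed
    finally show "(\<integral>\<^sup>+y. ?f (x(j := y)) \<partial>lborel) = \<dots>" .
  qed
  also have "\<dots> = ennreal (Beta (a j) b) * ennreal ((\<Prod>i\<in>I. Gamma (a i)) * Gamma (a j + b) /
      Gamma ((\<Sum>i\<in>I. a i) + (a j + b)) * t powr ((\<Sum>i\<in>I. a i) + (a j + b) - 1))"
  proof -
    have "a j + b > 0" using aj insert.prems(2) by linarith
    note IH = insert.IH[OF aI this insert.prems(3)]
    show ?thesis
      using insert.hyps(1) by (subst nn_integral_cmult, measurable) (simp only: IH)
  qed
  also have "\<dots> = ennreal (Beta (a j) b * ((\<Prod>i\<in>I. Gamma (a i)) * Gamma (a j + b) /
      Gamma ((\<Sum>i\<in>I. a i) + (a j + b)) * t powr ((\<Sum>i\<in>I. a i) + (a j + b) - 1)))"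
    using aj insert.prems(2)
    by (intro ennreal_mult'[symmetric])
      (auto simp: Beta_def intro!: divide_nonneg_nonneg mult_nonneg_nonneg less_imp_le[OF Gamma_real_pos])
  also have "Beta (a j) b * ((\<Prod>i\<in>I. Gamma (a i)) * Gamma (a j + b) /
      Gamma ((\<Sum>i\<in>I. a i) + (a j + b)) * t powr ((\<Sum>i\<in>I. a i) + (a j + b) - 1)) =
     (\<Prod>i\<in>insert j I. Gamma (a i)) * Gamma b / Gamma ((\<Sum>i\<in>insert j I. a i) + b) * t powr ((\<Sum>i\<in>insert j I. a i) + b - 1)"
  proof -
    have "a j + b > 0" using aj insert.prems(2) by linarith
    then have "Gamma (a j + b) \<noteq> 0" using less_imp_neq[OF Gamma_real_pos] by metis
    then show ?thesis using insert.hyps by (simp add: Beta_def add_ac mult_ac)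
  qed
  finally show ?case .
qed

lemma sets_dirichlet: "sets (dirichlet N \<alpha>) = sets (PiM {1..N} (\<lambda>_. borel))"
  by (simp add: dirichlet_def Let_def)

lemma measurable_complete_simplex:
  fixes N :: nat
  assumes "N \<ge> 1"
  shows "(\<lambda>p. p(N := 1 - (\<Sum>i\<in>{1..<N}. p i))) \<in>
    PiM {1..<N} (\<lambda>_. lborel) \<rightarrow>\<^sub>M PiM {1..N} (\<lambda>_. borel :: real measure)"
proof (rule measurable_fun_upd)
  show "{1..N} = {1..<N} \<union> {N}" using assms by auto
  have "sets (PiM {1..<N} (\<lambda>_. lborel)) = sets (PiM {1..<N} (\<lambda>_. borel :: real measure))"
    by (intro sets_PiM_cong) auto
  then show "(\<lambda>p. p) \<in> PiM {1..<N} (\<lambda>_. lborel) \<rightarrow>\<^sub>M PiM {1..<N} (\<lambda>_. borel :: real measure)"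
    by (intro measurable_ident_sets)
qed measurable

lemma measurable_dirichlet_density [measurable]:
  "dirichlet_density N \<alpha> \<in> borel_measurable (PiM {1..N} (\<lambda>_. borel))"
  unfolding dirichlet_density_def[abs_def] by measurable

lemma nn_integral_dirichlet:
  assumes N: "N \<ge> 1" and f[measurable]: "f \<in> borel_measurable (PiM {1..N} (\<lambda>_. borel))"
  shows "(\<integral>\<^sup>+p. f p \<partial>dirichlet N \<alpha>) =
    (\<integral>\<^sup>+p. ennreal (dirichlet_density N \<alpha> (p(N := 1 - (\<Sum>i\<in>{1..<N}. p i)))) *
       f (p(N := 1 - (\<Sum>i\<in>{1..<N}. p i))) \<partial>PiM {1..<N} (\<lambda>_. lborel))"
proof -
  note [measurable] = measurable_complete_simplex[OF N]
  show ?thesis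
    unfolding dirichlet_def Let_def
    by (subst nn_integral_distr, measurable) (subst nn_integral_density, measurable)
qed

text \<open>
  The coordinates are positive, not just nonnegative: \<open>0 powr a = 0\<close> for every \<open>a\<close>, so the density
  vanishes on the boundary of the simplex.
\<close>

lemma AE_dirichlet:
  assumes N: "N \<ge> 1"
  shows "AE p in dirichlet N \<alpha>. (\<forall>i\<in>{1..N}. 0 < p i) \<and> (\<Sum>i=1..N. p i) = 1"
proof -
  let ?b = "\<lambda>p. \<not> ((\<forall>i\<in>{1..N}. 0 < p i) \<and> (\<Sum>i=1..N. p i) = (1::real))"
  have [measurable]: "Measurable.pred (PiM {1..N} (\<lambda>_. borel)) ?b" by measurable
  have z: "ennreal (dirichlet_density N \<alpha> q) * (if ?b q then 1 else 0) = 0" for q :: "nat \<Rightarrow> real"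
  proof (cases "(\<forall>i\<in>{1..N}. 0 \<le> q i) \<and> (\<Sum>i=1..N. q i) = 1")
    case True
    show ?thesis
    proof (cases "\<forall>i\<in>{1..N}. 0 < q i")
      case False
      with True obtain i where "i \<in> {1..N}" "q i = 0" by force
      then have "(\<Prod>i=1..N. q i powr (\<alpha> i - 1)) = 0" by (intro prod_zero) auto
      then show ?thesis unfolding dirichlet_density_def by (simp only: mult_zero_right if_cancel ennreal_0 mult_zero_left)
    qed (use True in simp)
  qed (auto simp: dirichlet_density_def)
  have "(\<integral>\<^sup>+p. (if ?b p then 1 else 0) \<partial>dirichlet N \<alpha>) = 0"
    by (subst nn_integral_dirichlet[OF N], measurable) (simp only: z nn_integral_const, simp)
  then have "AE p in dirichlet N \<alpha>. (if ?b p then 1 else 0) = (0::ennreal)"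
    by (subst (asm) nn_integral_0_iff_AE) (auto simp: measurable_cong_sets[OF sets_dirichlet refl])
  then show ?thesis by (rule AE_mp) (auto split: if_splits)
qed

text \<open>
  Multiplying the density by powers of the coordinates only shifts the parameters, so the moments,
  with real exponents, are quotients of normalisation constants.
\<close>

lemma nn_integral_dirichlet_powr:
  fixes s :: "nat \<Rightarrow> real"
  assumes N: "N \<ge> 1" and \<alpha>: "\<And>i. i \<in> {1..N} \<Longrightarrow> \<alpha> i > 0"
    and s: "\<And>i. i \<in> {1..N} \<Longrightarrow> \<alpha> i + s i > 0"
  shows "(\<integral>\<^sup>+p. ennreal (\<Prod>i=1..N. p i powr s i) \<partial>dirichlet N \<alpha>) =
    ennreal (Gamma (\<Sum>i=1..N. \<alpha> i) / (\<Prod>i=1..N. Gamma (\<alpha> i)) *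
      ((\<Prod>i=1..N. Gamma (\<alpha> i + s i)) / Gamma (\<Sum>i=1..N. \<alpha> i + s i)))"
proof -
  let ?c = "Gamma (\<Sum>i=1..N. \<alpha> i) / (\<Prod>i=1..N. Gamma (\<alpha> i))"
  have ins: "{1..N} = insert N {1..<N}" using N by auto
  have c: "?c \<ge> 0"
    using \<alpha> N by (intro divide_nonneg_nonneg prod_nonneg less_imp_le[OF Gamma_real_pos] sum_pos) auto
  have ptw: "ennreal (dirichlet_density N \<alpha> (p(N := 1 - (\<Sum>i\<in>{1..<N}. p i)))) *
       ennreal (\<Prod>i=1..N. (p(N := 1 - (\<Sum>i\<in>{1..<N}. p i))) i powr s i) =
     ennreal ?c * ennreal (if (\<forall>i\<in>{1..<N}. 0 < p i) \<and> (\<Sum>i\<in>{1..<N}. p i) < 1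
        then (\<Prod>i\<in>{1..<N}. p i powr ((\<alpha> i + s i) - 1)) * (1 - (\<Sum>i\<in>{1..<N}. p i)) powr ((\<alpha> N + s N) - 1) else 0)"
    (is "ennreal (dirichlet_density N \<alpha> ?q) * ennreal ?m = ennreal ?c * ennreal ?r") for p :: "nat \<Rightarrow> real"
  proof -
    have sum1: "(\<Sum>i=1..N. ?q i) = 1"
      unfolding ins by (subst sum.insert) (auto intro!: sum.cong)
    have eq: "dirichlet_density N \<alpha> ?q * ?m = ?c * ?r"
    proof (cases "\<forall>i\<in>{1..N}. 0 \<le> ?q i")
      case False
      have "\<forall>i\<in>{1..N}. 0 \<le> ?q i" if "(\<forall>i\<in>{1..<N}. 0 < p i) \<and> (\<Sum>i\<in>{1..<N}. p i) < 1"
        using that unfolding ins by (auto intro: less_imp_le)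
      with False have F: "\<not> ((\<forall>i\<in>{1..<N}. 0 < p i) \<and> (\<Sum>i\<in>{1..<N}. p i) < 1)"
        by blast
      have "dirichlet_density N \<alpha> ?q = 0"
        unfolding dirichlet_density_def using False by (intro if_not_P) blast
      then show ?thesis unfolding if_not_P[OF F] by simp
    next
      case True
      have dm: "dirichlet_density N \<alpha> ?q * ?m = ?c * (\<Prod>i=1..N. ?q i powr (\<alpha> i + s i - 1))"
        unfolding dirichlet_density_def if_P[OF conjI[OF True sum1]] mult.assoc prod.distrib[symmetric]
        by (intro arg_cong2[where f="(*)"] refl prod.cong) (simp_all add: powr_add[symmetric] algebra_simps)
      show ?thesis
      proof (cases "\<forall>i\<in>{1..N}. 0 < ?q i")
        case T: True
        then have "(\<forall>i\<in>{1..<N}. 0 < p i) \<and> (\<Sum>i\<in>{1..<N}. p i) < 1"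
          unfolding ins by fastforce
        moreover have "(\<Prod>i=1..N. ?q i powr (\<alpha> i + s i - 1)) =
           (\<Prod>i\<in>{1..<N}. p i powr ((\<alpha> i + s i) - 1)) * (1 - (\<Sum>i\<in>{1..<N}. p i)) powr ((\<alpha> N + s N) - 1)"
          unfolding ins by (subst prod.insert) (auto intro!: prod.cong)
        ultimately show ?thesis unfolding dm by simp
      next
        case F: False
        then have nF: "\<not> ((\<forall>i\<in>{1..<N}. 0 < p i) \<and> (\<Sum>i\<in>{1..<N}. p i) < 1)"
          unfolding ins by (auto split: if_splits)
        from F True obtain i where "i \<in> {1..N}" "?q i = 0" by force
        then have P: "(\<Prod>i=1..N. ?q i powr (\<alpha> i + s i - 1)) = 0"
          by (intro prod_zero) (auto intro!: bexI[of _ i])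
        show ?thesis unfolding dm P if_not_P[OF nF] by simp
      qed
    qed
    have m: "?m \<ge> 0" by (intro prod_nonneg) simp
    show ?thesis
      unfolding ennreal_mult''[OF m, symmetric] ennreal_mult'[OF c, symmetric] eq ..
  qed
  have pos: "\<alpha> N + s N > 0" using s N by auto
  have "(\<integral>\<^sup>+p. ennreal (\<Prod>i=1..N. p i powr s i) \<partial>dirichlet N \<alpha>) =
     (\<integral>\<^sup>+p. ennreal ?c * ennreal (if (\<forall>i\<in>{1..<N}. 0 < p i) \<and> (\<Sum>i\<in>{1..<N}. p i) < 1
        then (\<Prod>i\<in>{1..<N}. p i powr ((\<alpha> i + s i) - 1)) * (1 - (\<Sum>i\<in>{1..<N}. p i)) powr ((\<alpha> N + s N) - 1) else 0)
       \<partial>PiM {1..<N} (\<lambda>_. lborel))"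
    by (subst nn_integral_dirichlet[OF N], measurable) (simp only: ptw)
  also have "\<dots> = ennreal ?c * ennreal ((\<Prod>i\<in>{1..<N}. Gamma (\<alpha> i + s i)) * Gamma (\<alpha> N + s N) /
      Gamma ((\<Sum>i\<in>{1..<N}. \<alpha> i + s i) + (\<alpha> N + s N)) * 1 powr ((\<Sum>i\<in>{1..<N}. \<alpha> i + s i) + (\<alpha> N + s N) - 1))"
  proof -
    have "\<And>i. i \<in> {1..<N} \<Longrightarrow> \<alpha> i + s i > 0" using s by auto
    note D = nn_integral_simplex[OF finite_atLeastLessThan this pos zero_less_one]
    show ?thesis
      by (subst nn_integral_cmult, measurable) (simp only: D)
  qed
  also have "\<dots> = ennreal (?c * ((\<Prod>i=1..N. Gamma (\<alpha> i + s i)) / Gamma (\<Sum>i=1..N. \<alpha> i + s i)))"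
  proof -
    have P: "(\<Prod>i=1..N. Gamma (\<alpha> i + s i)) = (\<Prod>i\<in>{1..<N}. Gamma (\<alpha> i + s i)) * Gamma (\<alpha> N + s N)"
      unfolding ins by (subst prod.insert) (simp_all add: mult.commute)
    have S: "(\<Sum>i=1..N. \<alpha> i + s i) = (\<Sum>i\<in>{1..<N}. \<alpha> i + s i) + (\<alpha> N + s N)"
      unfolding ins by (subst sum.insert) simp_all
    show ?thesis
      unfolding P S by (subst ennreal_mult'[OF c, symmetric]) simp
  qed
  finally show ?thesis .
qed

lemma prob_space_dirichlet:
  assumes N: "N \<ge> 1" and \<alpha>: "\<And>i. i \<in> {1..N} \<Longrightarrow> \<alpha> i > 0"
  shows "prob_space (dirichlet N \<alpha>)"
proof
  have ne: "Gamma (\<Sum>i=1..N. \<alpha> i) \<noteq> 0" "(\<Prod>i=1..N. Gamma (\<alpha> i)) \<noteq> 0"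
    using \<alpha> N Gamma_real_pos[OF sum_pos[of "{1..N}" \<alpha>]]
    by (auto simp: less_imp_neq[OF Gamma_real_pos, symmetric])
  have "emeasure (dirichlet N \<alpha>) (space (dirichlet N \<alpha>)) = (\<integral>\<^sup>+p. 1 \<partial>dirichlet N \<alpha>)"
    by simp
  also have "\<dots> = (\<integral>\<^sup>+p. ennreal (\<Prod>i=1..N. p i powr 0) \<partial>dirichlet N \<alpha>)"
  proof (rule nn_integral_cong_AE, rule AE_mp[OF AE_dirichlet[OF N]], intro AE_I2 impI)
    fix p :: "nat \<Rightarrow> real" assume p: "(\<forall>i\<in>{1..N}. 0 < p i) \<and> (\<Sum>i=1..N. p i) = 1"
    have "(\<Prod>i=1..N. p i powr 0) = 1"
      by (rule prod.neutral) (use p in auto)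
    then show "1 = ennreal (\<Prod>i=1..N. p i powr 0)" by simp
  qed
  also have "\<dots> = 1"
    using ne by (subst nn_integral_dirichlet_powr[OF N \<alpha>]) (auto simp: \<alpha>)
  finally show "emeasure (dirichlet N \<alpha>) (space (dirichlet N \<alpha>)) = 1" .
qed

text \<open>
  The value of \<open>E[\<Prod>i. p i powr t i]\<close> when \<open>p\<close> has the Dirichlet law with parameters \<open>\<alpha>\<close>,
  for \<open>\<alpha> + t > 0\<close>.
\<close>

definition dirichlet_moment :: "nat \<Rightarrow> (nat \<Rightarrow> real) \<Rightarrow> (nat \<Rightarrow> real) \<Rightarrow> real" where
  "dirichlet_moment N \<alpha> t = Gamma (\<Sum>i=1..N. \<alpha> i) / (\<Prod>i=1..N. Gamma (\<alpha> i)) *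
      ((\<Prod>i=1..N. Gamma (\<alpha> i + t i)) / Gamma (\<Sum>i=1..N. \<alpha> i + t i))"

lemma dirichlet_moment_pos:
  assumes N: "N \<ge> 1" and \<alpha>: "\<And>i. i \<in> {1..N} \<Longrightarrow> \<alpha> i > 0"
    and t: "\<And>i. i \<in> {1..N} \<Longrightarrow> \<alpha> i + t i > 0"
  shows "dirichlet_moment N \<alpha> t > 0"
  unfolding dirichlet_moment_def using assms
  by (intro mult_pos_pos divide_pos_pos prod_pos Gamma_real_pos sum_pos) auto

lemma Gamma_add_nat:
  fixes x :: real assumes "x > 0"
  shows "Gamma (x + real n) = Gamma x * pochhammer x n"
proof -
  have "x \<notin> \<int>\<^sub>\<le>\<^sub>0" using assms by (auto elim!: nonpos_Ints_cases)
  moreover have "Gamma x \<noteq> 0" using less_imp_neq[OF Gamma_real_pos[OF assms]] by simp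
  ultimately show ?thesis by (simp add: pochhammer_Gamma)
qed

text \<open>
  The moments of the shifted law with parameters \<open>\<alpha> + t\<close>: the second factor is the probability of
  a sequence of draws from a Polya urn with initial weights \<open>\<alpha> + t\<close> in which colour \<open>i\<close> is drawn
  \<open>n i\<close> times.
\<close>

lemma dirichlet_moment_add_nat:
  fixes n :: "nat \<Rightarrow> nat"
  assumes N: "N \<ge> 1" and t: "\<And>i. i \<in> {1..N} \<Longrightarrow> \<alpha> i + t i > 0"
  shows "dirichlet_moment N \<alpha> (\<lambda>i. t i + n i) = dirichlet_moment N \<alpha> t *
    ((\<Prod>i=1..N. pochhammer (\<alpha> i + t i) (n i)) / pochhammer (\<Sum>i=1..N. \<alpha> i + t i) (\<Sum>i=1..N. n i))"
proof -
  have P: "(\<Prod>i=1..N. Gamma (\<alpha> i + (t i + n i))) =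
     (\<Prod>i=1..N. Gamma (\<alpha> i + t i)) * (\<Prod>i=1..N. pochhammer (\<alpha> i + t i) (n i))"
    unfolding prod.distrib[symmetric]
    by (intro prod.cong refl) (use t Gamma_add_nat in \<open>simp add: add.assoc[symmetric]\<close>)
  have "(\<Sum>i=1..N. \<alpha> i + t i) > 0" using N t by (intro sum_pos) auto
  then have "Gamma ((\<Sum>i=1..N. \<alpha> i + t i) + real (\<Sum>i=1..N. n i)) =
     Gamma (\<Sum>i=1..N. \<alpha> i + t i) * pochhammer (\<Sum>i=1..N. \<alpha> i + t i) (\<Sum>i=1..N. n i)"
    by (rule Gamma_add_nat)
  moreover have "(\<Sum>i=1..N. \<alpha> i + (t i + n i)) = (\<Sum>i=1..N. \<alpha> i + t i) + real (\<Sum>i=1..N. n i)"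
    by (simp add: sum.distrib)
  ultimately show ?thesis
    unfolding dirichlet_moment_def P by simp
qed

text \<open>
  The cost of tilting the law by \<open>p powr t\<close>. In the product the contributions of first order in \<open>t\<close>
  cancel. The factor \<open>Gamma (A + D) * Gamma (A - D)\<close> with the sums \<open>A\<close> of \<open>\<alpha>\<close> and \<open>D\<close> of \<open>t\<close> is in
  the denominator, where logarithmic convexity suffices.
\<close>

lemma dirichlet_moment_symmetric_le:
  assumes N: "N \<ge> 1" and \<alpha>: "\<And>i. i \<in> {1..N} \<Longrightarrow> \<alpha> i > 0"
    and t: "\<And>i. i \<in> {1..N} \<Longrightarrow> 0 \<le> t i" "\<And>i. i \<in> {1..N} \<Longrightarrow> t i \<le> \<alpha> i / 2"
  shows "dirichlet_moment N \<alpha> t * dirichlet_moment N \<alpha> (\<lambda>i. - t i) \<le>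
    exp ((\<Sum>i=1..N. \<bar>Polygamma 1 (\<alpha> i / 2)\<bar>) * (\<Sum>i=1..N. (t i)\<^sup>2))"
proof -
  define A where "A = (\<Sum>i=1..N. \<alpha> i)"
  define D where "D = (\<Sum>i=1..N. t i)"
  define C where "C = (\<Sum>i=1..N. \<bar>Polygamma 1 (\<alpha> i / 2)\<bar>)"
  define Q where "Q = (\<Prod>i=1..N. Gamma (\<alpha> i))"
  have Apos: "A > 0" unfolding A_def using N \<alpha> by (intro sum_pos) auto
  have "D \<le> A / 2" unfolding A_def D_def sum_divide_distrib using t by (intro sum_mono) auto
  moreover have "0 \<le> D" unfolding D_def using t by (intro sum_nonneg) auto
  ultimately have D: "\<bar>D\<bar> < A" using Apos by linarith
  have Q: "Q > 0" unfolding Q_def using \<alpha> by (intro prod_pos) auto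
  have Gpos: "Gamma (A + D) * Gamma (A - D) > 0"
    using D by (intro mult_pos_pos Gamma_real_pos) auto
  have sums: "(\<Sum>i=1..N. \<alpha> i + t i) = A + D" "(\<Sum>i=1..N. \<alpha> i + - t i) = A - D"
    by (simp_all add: A_def D_def sum.distrib sum_subtractf)
  have "(\<Prod>i=1..N. Gamma (\<alpha> i + t i)) * (\<Prod>i=1..N. Gamma (\<alpha> i + - t i)) =
      (\<Prod>i=1..N. Gamma (\<alpha> i + t i) * Gamma (\<alpha> i - t i))"
    by (simp add: prod.distrib)
  also have "\<dots> \<le> (\<Prod>i=1..N. exp (C * (t i)\<^sup>2) * (Gamma (\<alpha> i))\<^sup>2)"
  proof (intro prod_mono conjI)
    fix i assume i: "i \<in> {1..N}"
    show "0 \<le> Gamma (\<alpha> i + t i) * Gamma (\<alpha> i - t i)"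
      using \<alpha>[OF i] t(1)[OF i] t(2)[OF i] by (intro mult_nonneg_nonneg less_imp_le[OF Gamma_real_pos]) auto
    have "Polygamma 1 (\<alpha> i / 2) \<le> C"
      unfolding C_def using member_le_sum[OF i, of "\<lambda>i. \<bar>Polygamma 1 (\<alpha> i / 2)\<bar>"] by force
    then have "exp (Polygamma 1 (\<alpha> i / 2) * (t i)\<^sup>2) \<le> exp (C * (t i)\<^sup>2)"
      by (simp add: mult_right_mono)
    then show "Gamma (\<alpha> i + t i) * Gamma (\<alpha> i - t i) \<le> exp (C * (t i)\<^sup>2) * (Gamma (\<alpha> i))\<^sup>2"
      using Gamma_symmetric_product_le[OF \<alpha>[OF i] t(1)[OF i] t(2)[OF i]]
      by (meson mult_right_mono order_trans zero_le_power2)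
  qed
  also have "\<dots> = exp (C * (\<Sum>i=1..N. (t i)\<^sup>2)) * Q\<^sup>2"
    by (simp add: prod.distrib exp_sum[symmetric] sum_distrib_left Q_def prod_power_distrib)
  finally have num: "(\<Prod>i=1..N. Gamma (\<alpha> i + t i)) * (\<Prod>i=1..N. Gamma (\<alpha> i + - t i)) \<le>
     exp (C * (\<Sum>i=1..N. (t i)\<^sup>2)) * Q\<^sup>2" .
  have "dirichlet_moment N \<alpha> t * dirichlet_moment N \<alpha> (\<lambda>i. - t i) =
     ((Gamma A)\<^sup>2 / (Gamma (A + D) * Gamma (A - D))) *
     (((\<Prod>i=1..N. Gamma (\<alpha> i + t i)) * (\<Prod>i=1..N. Gamma (\<alpha> i + - t i))) / Q\<^sup>2)"
    unfolding dirichlet_moment_def sums A_def[symmetric] Q_def[symmetric]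
    by (simp add: power2_eq_square field_simps)
  also have "\<dots> \<le> 1 * exp (C * (\<Sum>i=1..N. (t i)\<^sup>2))"
  proof (intro mult_mono)
    show "(Gamma A)\<^sup>2 / (Gamma (A + D) * Gamma (A - D)) \<le> 1"
      using Gamma_midpoint_le[OF D] Gpos by (simp add: divide_le_eq)
    show "(\<Prod>i=1..N. Gamma (\<alpha> i + t i)) * (\<Prod>i=1..N. Gamma (\<alpha> i + - t i)) / Q\<^sup>2 \<le> exp (C * (\<Sum>i=1..N. (t i)\<^sup>2))"
      using num Q by (simp add: divide_le_eq)
    show "0 \<le> (\<Prod>i=1..N. Gamma (\<alpha> i + t i)) * (\<Prod>i=1..N. Gamma (\<alpha> i + - t i)) / Q\<^sup>2"
    proof (intro divide_nonneg_nonneg mult_nonneg_nonneg prod_nonneg ballI less_imp_le[OF Gamma_real_pos])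
      fix i assume i: "i \<in> {1..N}"
      show "0 < \<alpha> i + t i" "0 < \<alpha> i + - t i" using \<alpha>[OF i] t(1)[OF i] t(2)[OF i] by auto
    qed simp
  qed simp
  finally show ?thesis by (simp add: C_def)
qed

section \<open>Trails and the urn weight\<close>

text \<open>
  The numerator, and with sums of weights the denominator, of the probability of a sequence of
  Polya urn draws with result \<open>M\<close>: each repetition of \<open>x\<close> adds \<open>1\<close> to the weight \<open>f x\<close>.
\<close>

definition pochhammer_mset :: "('b \<Rightarrow> real) \<Rightarrow> 'b multiset \<Rightarrow> real" where
  "pochhammer_mset f M = (\<Prod>x\<in>set_mset M. pochhammer (f x) (count M x))"

lemma pochhammer_mset_superset:
  assumes "finite A" "set_mset M \<subseteq> A"
  shows "pochhammer_mset f M = (\<Prod>x\<in>A. pochhammer (f x) (count M x))"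
  unfolding pochhammer_mset_def
  using assms by (intro prod.mono_neutral_left) (auto simp: not_in_iff)

lemma pochhammer_mset_empty [simp]: "pochhammer_mset f {#} = 1"
  by (simp add: pochhammer_mset_def)

lemma pochhammer_mset_add:
  "pochhammer_mset f (add_mset x M) = pochhammer_mset f M * (f x + count M x)"
proof -
  let ?A = "insert x (set_mset M)"
  have "pochhammer_mset f (add_mset x M) = (\<Prod>y\<in>?A. pochhammer (f y) (count (add_mset x M) y))"
    by (rule pochhammer_mset_superset) auto
  also have "\<dots> = pochhammer (f x) (Suc (count M x)) * (\<Prod>y\<in>?A - {x}. pochhammer (f y) (count (add_mset x M) y))"
    by (subst prod.remove[of _ x]) auto
  also have "(\<Prod>y\<in>?A - {x}. pochhammer (f y) (count (add_mset x M) y)) =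
      (\<Prod>y\<in>?A - {x}. pochhammer (f y) (count M y))"
    by (intro prod.cong) auto
  also have "pochhammer (f x) (Suc (count M x)) * \<dots> =
      (pochhammer (f x) (count M x) * \<dots>) * (f x + count M x)"
    by (simp add: pochhammer_Suc mult_ac)
  also have "pochhammer (f x) (count M x) * (\<Prod>y\<in>?A - {x}. pochhammer (f y) (count M y)) =
      (\<Prod>y\<in>?A. pochhammer (f y) (count M y))"
    by (subst (2) prod.remove[of _ x]) auto
  also have "\<dots> = pochhammer_mset f M"
    by (rule pochhammer_mset_superset[symmetric]) auto
  finally show ?thesis .
qed

lemma pochhammer_mset_pos:
  assumes "\<And>x. x \<in># M \<Longrightarrow> f x > 0"
  shows "pochhammer_mset f M > 0"
  unfolding pochhammer_mset_def using assms by (intro prod_pos pochhammer_pos) auto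

text \<open>
  Since \<open>1 / (b + j) \<ge> ln (b + j + 1) - ln (b + j)\<close>, the product telescopes to at most
  \<open>(b / (b + k)) powr \<gamma>\<close>.
\<close>

lemma prod_one_minus_tendsto_0:
  fixes b \<gamma> :: real
  assumes "b > 0" "\<gamma> > 0" "\<gamma> \<le> b"
  shows "(\<lambda>k. \<Prod>j<k. 1 - \<gamma> / (b + real j)) \<longlonglongrightarrow> 0"
proof (rule tendsto_sandwich[where f = "\<lambda>_. 0" and h = "\<lambda>k. exp (\<gamma> * (ln b - ln (b + real k)))"])
  have nn: "0 \<le> 1 - \<gamma> / (b + real j)" for j
    using assms by (simp add: divide_le_eq)
  then show "\<forall>\<^sub>F k in sequentially. 0 \<le> (\<Prod>j<k. 1 - \<gamma> / (b + real j))"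
    by (intro always_eventually allI prod_nonneg) auto
  have fac: "1 - \<gamma> / (b + real j) \<le> exp (\<gamma> * (ln (b + real j) - ln (b + real (Suc j))))" for j
  proof -
    have pos: "b + real j > 0" using assms by simp
    have "ln (b + real (Suc j)) - ln (b + real j) = ln (1 + 1 / (b + real j))"
    proof -
      have "1 + 1 / (b + real j) = (b + real (Suc j)) / (b + real j)"
        using pos by (simp add: field_simps)
      then show ?thesis using pos by (simp add: ln_div)
    qed
    also have "\<dots> \<le> 1 / (b + real j)"
      using pos by (intro ln_add_one_self_le_self) simp
    finally have "\<gamma> * (ln (b + real (Suc j)) - ln (b + real j)) \<le> \<gamma> * (1 / (b + real j))"
      using assms by (intro mult_left_mono) auto
    then have "- \<gamma> / (b + real j) \<le> \<gamma> * (ln (b + real j) - ln (b + real (Suc j)))"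
      by (simp add: algebra_simps)
    then have *: "exp (- \<gamma> / (b + real j)) \<le> exp (\<gamma> * (ln (b + real j) - ln (b + real (Suc j))))"
      by simp
    have "1 + (- \<gamma> / (b + real j)) \<le> exp (- \<gamma> / (b + real j))"
      by (rule exp_ge_add_one_self)
    from order_trans[OF this *] show ?thesis by simp
  qed
  have "(\<Prod>j<k. 1 - \<gamma> / (b + real j)) \<le> exp (\<gamma> * (ln b - ln (b + real k)))" for k
  proof (induction k)
    case (Suc k)
    have "(\<Prod>j<Suc k. 1 - \<gamma> / (b + real j)) \<le>
       exp (\<gamma> * (ln b - ln (b + real k))) * exp (\<gamma> * (ln (b + real k) - ln (b + real (Suc k))))"
      unfolding prod.lessThan_Suc using Suc fac[of k] nn by (intro mult_mono) auto
    also have "\<dots> = exp (\<gamma> * (ln b - ln (b + real (Suc k))))"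
      by (simp add: exp_add[symmetric] algebra_simps)
    finally show ?case .
  qed simp
  then show "\<forall>\<^sub>F k in sequentially. (\<Prod>j<k. 1 - \<gamma> / (b + real j)) \<le> exp (\<gamma> * (ln b - ln (b + real k)))"
    by (intro always_eventually allI)
  show "(\<lambda>k. exp (\<gamma> * (ln b - ln (b + real k)))) \<longlonglongrightarrow> 0"
  proof -
    have "filterlim (\<lambda>k. ln (b + real k)) at_top sequentially"
      by (intro filterlim_compose[OF ln_at_top] filterlim_tendsto_add_at_top[OF tendsto_const]
          filterlim_real_sequentially)
    then have "filterlim (\<lambda>k. \<gamma> * (- ln b + ln (b + real k))) at_top sequentially"
      using assms(2) by (intro filterlim_tendsto_pos_mult_at_top[OF tendsto_const]
          filterlim_tendsto_add_at_top[OF tendsto_const]) auto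
    moreover have "\<gamma> * (- ln b + ln (b + real k)) = - (\<gamma> * (ln b - ln (b + real k)))" for k
      by (simp add: algebra_simps)
    ultimately have "filterlim (\<lambda>k. \<gamma> * (ln b - ln (b + real k))) at_bot sequentially"
      by (simp add: filterlim_uminus_at_bot)
    then show ?thesis by (rule filterlim_compose[OF exp_at_bot])
  qed
qed simp

text \<open>
  The part of the structure of a Cayley graph that matters here: for each \<open>i\<close> the edges labelled
  \<open>i\<close> form a permutation \<open>s i\<close> of the vertices, with inverse \<open>r i\<close>. An edge is a pair \<open>(x, i)\<close> of
  its tail and its label. By \<open>s_inj\<close> no two edges are parallel, so that a jump of the
  walk determines the label.
\<close>

locale permutation_digraph =
  fixes V :: "'a set" and d :: nat and s r :: "nat \<Rightarrow> 'a \<Rightarrow> 'a"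
  assumes d_pos: "d \<ge> 1"
    and s_in [simp]: "\<And>i x. i \<in> {1..d} \<Longrightarrow> x \<in> V \<Longrightarrow> s i x \<in> V"
    and r_in [simp]: "\<And>i x. i \<in> {1..d} \<Longrightarrow> x \<in> V \<Longrightarrow> r i x \<in> V"
    and r_s [simp]: "\<And>i x. i \<in> {1..d} \<Longrightarrow> x \<in> V \<Longrightarrow> r i (s i x) = x"
    and s_r [simp]: "\<And>i x. i \<in> {1..d} \<Longrightarrow> x \<in> V \<Longrightarrow> s i (r i x) = x"
    and s_inj: "\<And>x. x \<in> V \<Longrightarrow> inj_on (\<lambda>i. s i x) {1..d}"
begin

definition head :: "'a \<times> nat \<Rightarrow> 'a" where
  "head e = s (snd e) (fst e)"

lemma head_Pair [simp]: "head (x, i) = s i x"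
  by (simp add: head_def)

fun trail :: "'a \<Rightarrow> ('a \<times> nat) list \<Rightarrow> 'a \<Rightarrow> bool" where
  "trail x [] y \<longleftrightarrow> x = y"
| "trail x (e # es) y \<longleftrightarrow> fst e = x \<and> snd e \<in> {1..d} \<and> trail (head e) es y"

lemma trail_snoc:
  "trail x (es @ [e]) y \<longleftrightarrow> trail x es (fst e) \<and> snd e \<in> {1..d} \<and> head e = y"
  by (induction es arbitrary: x) auto

lemma trail_in:
  assumes "x \<in> V" "trail x es y"
  shows "y \<in> V" "set es \<subseteq> V \<times> {1..d}"
proof -
  have "y \<in> V \<and> set es \<subseteq> V \<times> {1..d}"
    using assms
  proof (induction es arbitrary: x)
    case (Cons e es)
    then have h: "head e \<in> V" "trail (head e) es y" by (auto simp: head_def)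
    show ?case using Cons.IH[OF h] Cons.prems by (cases e) auto
  qed simp
  then show "y \<in> V" "set es \<subseteq> V \<times> {1..d}" by auto
qed

text \<open>
  Up to its end points, a trail enters every vertex as often as it leaves it. For closed trails this
  is what allows the reading in the reverse direction.
\<close>

lemma trail_balanced:
  assumes "trail x es y"
  shows "add_mset x (image_mset head (mset es)) = add_mset y (image_mset fst (mset es))"
  using assms
proof (induction es arbitrary: x)
  case (Cons e es)
  then have "add_mset (head e) (image_mset head (mset es)) = add_mset y (image_mset fst (mset es))"
    by auto
  with Cons.prems show ?case by (auto simp: add_mset_commute)
qed auto

text \<open>
  The vertex \<open>z\<close> is the one whose visits are counted; the start of the trail is not a visit.
\<close>

definition trails :: "'a \<Rightarrow> 'a \<Rightarrow> 'a \<Rightarrow> nat \<Rightarrow> nat \<Rightarrow> ('a \<times> nat) list set" where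
  "trails z x y k L = {es. trail x es y \<and> length es \<le> L \<and> count_list (map head es) z = k}"

lemma finite_trails_from: "finite {es. (\<exists>y. trail x es y) \<and> length es = n}"
proof (induction n arbitrary: x)
  case (Suc n)
  have "{es. (\<exists>y. trail x es y) \<and> length es = Suc n} \<subseteq>
      (\<Union>i\<in>{1..d}. Cons (x, i) ` {es. (\<exists>y. trail (s i x) es y) \<and> length es = n})"
    by (auto simp: length_Suc_conv image_iff)
  then show ?case by (rule finite_subset) (use Suc in auto)
qed simp

lemma finite_trails [simp]: "finite (trails z x y k L)"
proof (rule finite_subset)
  show "trails z x y k L \<subseteq> (\<Union>n\<le>L. {es. (\<exists>y. trail x es y) \<and> length es = n})"
    by (auto simp: trails_def)
qed (use finite_trails_from in auto)

lemma sum_Cons_edges: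
  assumes "\<And>i. i \<in> {1..d} \<Longrightarrow> finite (B i)"
  shows "sum f (\<Union>i\<in>{1..d}. Cons (x, i) ` B i) = (\<Sum>i=1..d. \<Sum>es\<in>B i. f ((x, i) # es))"
  using assms by (subst sum.UNION_disjoint) (auto intro!: sum.cong sum.reindex[unfolded o_def] simp: inj_on_def)

lemma sum_snoc_edges:
  assumes "\<And>i. i \<in> {1..d} \<Longrightarrow> finite (B i)"
  shows "sum f (\<Union>i\<in>{1..d}. (\<lambda>es. es @ [(y i, i)]) ` B i) = (\<Sum>i=1..d. \<Sum>es\<in>B i. f (es @ [(y i, i)]))"
  using assms by (subst sum.UNION_disjoint) (auto intro!: sum.cong sum.reindex[unfolded o_def] simp: inj_on_def)

text \<open>
  First-step decomposition, the one that matches the recursion of the walk.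
\<close>

lemma trails_Cons:
  assumes "k > 0"
  shows "trails z x z k (Suc L) =
    (\<Union>i\<in>{1..d}. Cons (x, i) ` trails z (s i x) z (if s i x = z then k - 1 else k) L)" (is "?A = ?B")
proof (rule Set.set_eqI)
  fix es show "es \<in> ?A \<longleftrightarrow> es \<in> ?B"
  proof (cases es)
    case (Cons e es')
    have "es \<in> ?A \<longleftrightarrow> fst e = x \<and> snd e \<in> {1..d} \<and>
        es' \<in> trails z (head e) z (if head e = z then k - 1 else k) L"
      using assms by (cases k) (auto simp: trails_def Cons)
    also have "\<dots> \<longleftrightarrow> es \<in> ?B"
      by (cases e) (auto simp: Cons)
    finally show ?thesis .
  qed (use assms in \<open>auto simp: trails_def\<close>)
qed

text \<open>
  Last-step decomposition, the one that matches the recursion of the reversed walk.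
\<close>

lemma trails_snoc:
  assumes "x \<in> V" "z \<in> V" "x \<noteq> z \<or> k > 0"
  shows "trails z z x k (Suc L) =
    (\<Union>i\<in>{1..d}. (\<lambda>es. es @ [(r i x, i)]) ` trails z z (r i x) (if x = z then k - 1 else k) L)" (is "?A = ?B")
proof (rule Set.set_eqI)
  fix es show "es \<in> ?A \<longleftrightarrow> es \<in> ?B"
  proof (cases es rule: rev_cases)
    case Nil
    then show ?thesis using assms by (auto simp: trails_def)
  next
    case (snoc es' e)
    show ?thesis
    proof
      assume "es \<in> ?A"
      then have es: "trail z es' (fst e)" "snd e \<in> {1..d}" "head e = x" "length es' \<le> L"
        "count_list (map head es') z + (if x = z then 1 else 0) = k"
        by (auto simp: snoc trails_def trail_snoc)
      have "fst e \<in> V" using trail_in[OF assms(2) es(1)] by simp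
      then have "fst e = r (snd e) x" using es(2,3) by (auto simp: head_def)
      then have "e = (r (snd e) x, snd e)" by (cases e) auto
      moreover have "es' \<in> trails z z (r (snd e) x) (if x = z then k - 1 else k) L"
        using es \<open>fst e = r (snd e) x\<close> by (auto simp: trails_def)
      ultimately show "es \<in> ?B" using es(2) snoc by blast
    next
      assume "es \<in> ?B"
      then show "es \<in> ?A" using assms by (auto simp: trails_def trail_snoc)
    qed
  qed
qed

text \<open>
  The probability that a reinforced walk with initial edge weights \<open>\<beta>\<close>, which traverses edges
  backwards, uses the edges of \<open>C\<close> in a given order. At \<open>x\<close> it chooses an edge with head \<open>x\<close>, with
  probability proportional to the weight plus the number of previous uses, and with a denominator
  of \<open>b x\<close> plus the number of previous choices at \<open>x\<close>; it is killed at \<open>x\<close> with positive probability if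
  \<open>b x\<close> exceeds the sum of the weights. By the exchangeability of Polya's urn,
  the probability depends only on the multiset \<open>C\<close>.
\<close>

definition urn_weight :: "('a \<times> nat \<Rightarrow> real) \<Rightarrow> ('a \<Rightarrow> real) \<Rightarrow> ('a \<times> nat) multiset \<Rightarrow> real" where
  "urn_weight \<beta> b C = pochhammer_mset \<beta> C / pochhammer_mset b (image_mset head C)"

lemma urn_weight_add:
  "urn_weight \<beta> b (add_mset e C) =
     urn_weight \<beta> b C * ((\<beta> e + count C e) / (b (head e) + count (image_mset head C) (head e)))"
  by (simp add: urn_weight_def pochhammer_mset_add)

lemma sum_count_incoming_le:
  assumes "x \<in> V"
  shows "(\<Sum>i=1..d. count C (r i x, i)) \<le> count (image_mset head C) x"
proof -
  have "(\<Sum>i=1..d. count C (r i x, i)) = (\<Sum>e\<in>(\<lambda>i. (r i x, i)) ` {1..d}. count C e)"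
    by (subst sum.reindex) (auto simp: inj_on_def)
  also have "\<dots> = (\<Sum>e\<in>(\<lambda>i. (r i x, i)) ` {1..d} \<inter> set_mset C. count C e)"
    by (intro sum.mono_neutral_right) (auto simp: not_in_iff)
  also have "\<dots> \<le> (\<Sum>e\<in>{e. e \<in># C \<and> x = head e}. count C e)"
    using assms by (intro sum_mono2) auto
  also have "\<dots> = count (image_mset head C) x"
    by (simp add: count_image_mset')
  finally show ?thesis .
qed

text \<open>
  The left-hand side sums over all ways in which the reversed reinforced walk, which has already used
  the edges in \<open>C\<close>, gets from \<open>x\<close> to its last arrival at \<open>z\<close> with \<open>k\<close> departures from \<open>z\<close> within
  \<open>L\<close> steps. By induction on \<open>L\<close>, its next step is the last edge of the trail. The choices at a vertex
  \<open>x \<noteq> z\<close> have total probability at most \<open>1\<close>; at \<open>z\<close> the weight \<open>\<gamma>\<close> is missing among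
  the incoming edges, so each departure from \<open>z\<close> contributes one factor of the product.
\<close>

lemma sum_urn_weight_le:
  fixes \<beta> :: "'a \<times> nat \<Rightarrow> real" and b :: "'a \<Rightarrow> real" and \<gamma> :: real
  assumes z: "z \<in> V" and x: "x \<in> V" and \<gamma>: "\<gamma> \<ge> 0"
    and \<beta>: "\<And>x i. x \<in> V \<Longrightarrow> i \<in> {1..d} \<Longrightarrow> \<beta> (x, i) > 0"
    and b: "\<And>x. x \<in> V \<Longrightarrow> (\<Sum>i=1..d. \<beta> (r i x, i)) = b x - (if x = z then \<gamma> else 0)"
    and C: "set_mset C \<subseteq> V \<times> {1..d}"
  shows "(\<Sum>es\<in>trails z z x k L. urn_weight \<beta> b (C + mset es)) \<le>
    urn_weight \<beta> b C * (\<Prod>j<k. 1 - \<gamma> / (b z + count (image_mset head C) z + real j))"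
  using x C
proof (induction L arbitrary: x k C)
  have b_pos: "b x > 0" if "x \<in> V" for x
  proof -
    have "0 < (\<Sum>i=1..d. \<beta> (r i x, i))"
      using d_pos that \<beta> by (intro sum_pos) auto
    then show ?thesis using b[OF that] \<gamma> by (auto split: if_splits)
  qed
  have bz: "b z \<ge> \<gamma>"
  proof -
    have "0 \<le> (\<Sum>i=1..d. \<beta> (r i z, i))"
      using z by (intro sum_nonneg less_imp_le[OF \<beta>]) auto
    then show ?thesis using b[OF z] by simp
  qed
  have fac: "0 \<le> 1 - \<gamma> / (b z + real m + real j)" for m j :: nat
    using bz b_pos[OF z] by (simp add: divide_le_eq)
  have w: "urn_weight \<beta> b C \<ge> 0" if "set_mset C \<subseteq> V \<times> {1..d}" for C
    unfolding urn_weight_def using that \<beta> b_pos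
    by (intro divide_nonneg_nonneg less_imp_le[OF pochhammer_mset_pos]) auto
  {
    case 0
    show ?case
    proof (cases "x = z \<and> k = 0")
      case True
      then have "trails z z x k 0 = {[]}" by (auto simp: trails_def)
      then show ?thesis using True by simp
    next
      case False
      then have "trails z z x k 0 = {}" by (auto simp: trails_def)
      then show ?thesis
        using 0 by (auto intro!: mult_nonneg_nonneg prod_nonneg fac w)
    qed
  next
    case (Suc L)
    show ?case
    proof (cases "x = z \<and> k = 0")
      case True
      have "trails z z x k (Suc L) = {[]}"
      proof (intro Set.set_eqI iffI)
        fix es assume es: "es \<in> trails z z x k (Suc L)"
        then show "es \<in> {[]}"
          using True by (cases es rule: rev_cases) (auto simp: trails_def trail_snoc)
      qed (use True in \<open>auto simp: trails_def\<close>)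
      then show ?thesis using True by simp
    next
      case False
      define k' where "k' = (if x = z then k - 1 else k)"
      define N where "N = b z + real (count (image_mset head C) z)"
      define N' where "N' = N + (if x = z then 1 else 0)"
      define m where "m = b x + real (count (image_mset head C) x)"
      define P where "P = (\<Prod>j<k'. 1 - \<gamma> / (N' + real j))"
      have m: "m > 0" using b_pos[OF Suc.prems(1)] by (simp add: m_def)
      have P: "P \<ge> 0"
        unfolding P_def N'_def N_def
        using fac[of "count (image_mset head C) z + 1"] fac[of "count (image_mset head C) z"]
        by (intro prod_nonneg) (simp add: add_ac)
      have "(\<Sum>es\<in>trails z z x k (Suc L). urn_weight \<beta> b (C + mset es)) =
          (\<Sum>i=1..d. \<Sum>es\<in>trails z z (r i x) k' L. urn_weight \<beta> b (C + mset (es @ [(r i x, i)])))"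
      proof -
        have "x \<noteq> z \<or> k > 0" using False by auto
        note T = trails_snoc[OF Suc.prems(1) z this, folded k'_def]
        show ?thesis unfolding T by (rule sum_snoc_edges) simp
      qed
      also have "\<dots> \<le> (\<Sum>i=1..d. urn_weight \<beta> b (add_mset (r i x, i) C) * P)"
      proof (intro sum_mono)
        fix i assume i: "i \<in> {1..d}"
        have "(\<Sum>es\<in>trails z z (r i x) k' L. urn_weight \<beta> b (C + mset (es @ [(r i x, i)]))) =
          (\<Sum>es\<in>trails z z (r i x) k' L. urn_weight \<beta> b (add_mset (r i x, i) C + mset es))"
          by (intro sum.cong) auto
        also have "\<dots> \<le> urn_weight \<beta> b (add_mset (r i x, i) C) *
            (\<Prod>j<k'. 1 - \<gamma> / (b z + count (image_mset head (add_mset (r i x, i) C)) z + real j))"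
          using i Suc.prems by (intro Suc.IH) auto
        also have "(\<Prod>j<k'. 1 - \<gamma> / (b z + count (image_mset head (add_mset (r i x, i) C)) z + real j)) = P"
          using i Suc.prems unfolding P_def N'_def N_def by (intro prod.cong) (auto simp: add_ac)
        finally show "(\<Sum>es\<in>trails z z (r i x) k' L. urn_weight \<beta> b (C + mset (es @ [(r i x, i)]))) \<le>
          urn_weight \<beta> b (add_mset (r i x, i) C) * P" .
      qed
      also have "\<dots> = (\<Sum>i=1..d. urn_weight \<beta> b C * P * ((\<beta> (r i x, i) + count C (r i x, i)) / m))"
        unfolding m_def using Suc.prems by (intro sum.cong) (auto simp: urn_weight_add)
      also have "\<dots> = urn_weight \<beta> b C * P * ((\<Sum>i=1..d. \<beta> (r i x, i) + count C (r i x, i)) / m)"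
        by (simp add: sum_distrib_left sum_divide_distrib)
      also have "\<dots> \<le> urn_weight \<beta> b C * P * (if x = z then 1 - \<gamma> / m else 1)"
      proof (intro mult_left_mono)
        have "(\<Sum>i=1..d. \<beta> (r i x, i) + count C (r i x, i)) =
          b x - (if x = z then \<gamma> else 0) + real (\<Sum>i=1..d. count C (r i x, i))"
          using b[OF Suc.prems(1)] by (simp add: sum.distrib)
        also have "\<dots> \<le> m - (if x = z then \<gamma> else 0)"
          unfolding m_def using of_nat_mono[OF sum_count_incoming_le[OF Suc.prems(1), of C], where ?'a = real] by linarith
        finally have "(\<Sum>i=1..d. \<beta> (r i x, i) + count C (r i x, i)) / m \<le> (m - (if x = z then \<gamma> else 0)) / m"
          using m by (intro divide_right_mono) auto
        also have "\<dots> = (if x = z then 1 - \<gamma> / m else 1)"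
          using m by (simp add: diff_divide_distrib)
        finally show "(\<Sum>i=1..d. \<beta> (r i x, i) + count C (r i x, i)) / m \<le> (if x = z then 1 - \<gamma> / m else 1)" .
      qed (use P w Suc.prems in auto)
      also have "\<dots> = urn_weight \<beta> b C * (\<Prod>j<k. 1 - \<gamma> / (N + real j))"
      proof (cases "x = z")
        case True
        with False obtain k0 where k: "k = Suc k0" by (cases k) auto
        have "(\<Prod>j<k. 1 - \<gamma> / (N + real j)) = (1 - \<gamma> / N) * (\<Prod>j<k0. 1 - \<gamma> / (N + real (Suc j)))"
          unfolding k by (subst prod.lessThan_Suc_shift) simp
        then show ?thesis
          using True k by (simp add: P_def k'_def N'_def m_def N_def add_ac mult_ac)
      qed (simp add: P_def k'_def N'_def)
      finally show ?thesis by (simp add: N_def)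
    qed
  }
qed

section \<open>Visits of the walk to a vertex\<close>

definition environment :: "('a \<Rightarrow> nat \<Rightarrow> real) \<Rightarrow> bool" where
  "environment p \<longleftrightarrow> (\<forall>x\<in>V. (\<forall>i\<in>{1..d}. 0 \<le> p x i) \<and> (\<Sum>i=1..d. p x i) = 1)"

definition trail_weight :: "('a \<Rightarrow> nat \<Rightarrow> real) \<Rightarrow> ('a \<times> nat) list \<Rightarrow> real" where
  "trail_weight p es = (\<Prod>(x, i)\<leftarrow>es. p x i)"

lemma trail_weight_simps [simp]:
  "trail_weight p [] = 1" "trail_weight p ((x, i) # es) = p x i * trail_weight p es"
  by (simp_all add: trail_weight_def)

lemma trail_weight_nonneg:
  assumes "environment p" "set es \<subseteq> V \<times> {1..d}"
  shows "trail_weight p es \<ge> 0"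
  using assms by (induction es) (auto simp: environment_def)

text \<open>
  The probability that the walk from \<open>x\<close> makes at least \<open>k\<close> visits to \<open>z\<close> at the times
  \<open>1, \<dots>, L\<close>, by the first-step recursion.
\<close>

fun visit :: "('a \<Rightarrow> nat \<Rightarrow> real) \<Rightarrow> 'a \<Rightarrow> nat \<Rightarrow> nat \<Rightarrow> 'a \<Rightarrow> real" where
  "visit p z 0 L x = 1"
| "visit p z (Suc k) 0 x = 0"
| "visit p z (Suc k) (Suc L) x =
    (\<Sum>i=1..d. p x i * (if s i x = z then visit p z k L z else visit p z (Suc k) L (s i x)))"

lemma visit_bounds:
  assumes "environment p" "z \<in> V" "x \<in> V"
  shows "0 \<le> visit p z k L x" "visit p z k L x \<le> 1"
proof -
  have "x \<in> V \<longrightarrow> 0 \<le> visit p z k L x \<and> visit p z k L x \<le> 1"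
    using assms(1,2)
  proof (induction p z k L x rule: visit.induct)
    case (3 p z k L x)
    show ?case
    proof (intro impI conjI)
      assume x: "x \<in> V"
      have p: "\<And>i. i \<in> {1..d} \<Longrightarrow> 0 \<le> p x i" "(\<Sum>i=1..d. p x i) = 1"
        using 3 x by (auto simp: environment_def)
      let ?q = "\<lambda>i. if s i x = z then visit p z k L z else visit p z (Suc k) L (s i x)"
      have q: "0 \<le> ?q i \<and> ?q i \<le> 1" if "i \<in> {1..d}" for i
        using 3 x that by auto
      show "0 \<le> visit p z (Suc k) (Suc L) x"
        using p q by (auto intro!: sum_nonneg mult_nonneg_nonneg simp del: if_split)
      have "(\<Sum>i=1..d. p x i * ?q i) \<le> (\<Sum>i=1..d. p x i * 1)"
        using p q by (intro sum_mono mult_left_mono) auto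
      then show "visit p z (Suc k) (Suc L) x \<le> 1" using p by simp
    qed
  qed auto
  then show "0 \<le> visit p z k L x" "visit p z k L x \<le> 1" using assms by auto
qed

lemma visit_Suc_mono:
  assumes "environment p" "z \<in> V" "x \<in> V"
  shows "visit p z k L x \<le> visit p z k (Suc L) x"
proof -
  have "x \<in> V \<longrightarrow> visit p z k L x \<le> visit p z k (Suc L) x"
    using assms(1,2)
  proof (induction p z k L x rule: visit.induct)
    case (2 p z k x)
    then show ?case using visit_bounds(1)[of p z x "Suc k" "Suc 0"] by (auto simp del: visit.simps(3))
  next
    case (3 p z k L x)
    show ?case
    proof
      assume x: "x \<in> V"
      show "visit p z (Suc k) (Suc L) x \<le> visit p z (Suc k) (Suc (Suc L)) x"
        unfolding visit.simps(3)[of p z k "Suc L" x] visit.simps(3)[of p z k L x]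
      proof (intro sum_mono mult_left_mono)
        fix i assume i: "i \<in> {1..d}"
        show "0 \<le> p x i" using 3 x i by (auto simp: environment_def)
        show "(if s i x = z then visit p z k L z else visit p z (Suc k) L (s i x)) \<le>
          (if s i x = z then visit p z k (Suc L) z else visit p z (Suc k) (Suc L) (s i x))"
          using 3 x i by (auto simp del: visit.simps)
      qed
    qed
  qed auto
  then show ?thesis using assms by auto
qed

lemma visit_mono:
  assumes "environment p" "z \<in> V" "x \<in> V" "L \<le> M"
  shows "visit p z k L x \<le> visit p z k M x"
  using lift_Suc_mono_le[where f = "\<lambda>L. visit p z k L x", OF visit_Suc_mono[OF assms(1-3)] assms(4)] .

text \<open>
  The strong Markov property at the first visit to \<open>z\<close>. Splitting the time deterministically as
  \<open>L + M\<close> gives a lower bound only, which is sharp in the limit.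
\<close>

lemma visit_mult_le:
  assumes "environment p" "z \<in> V" "x \<in> V"
  shows "visit p z 1 L x * visit p z k M z \<le> visit p z (Suc k) (L + M) x"
  using assms(3)
proof (induction L arbitrary: x)
  case 0
  then show ?case using visit_bounds(1)[OF assms(1,2)] by simp
next
  case (Suc L)
  have "visit p z 1 (Suc L) x * visit p z k M z =
     (\<Sum>i=1..d. p x i * ((if s i x = z then 1 else visit p z 1 L (s i x)) * visit p z k M z))"
    by (auto simp: sum_distrib_right mult.assoc intro!: sum.cong)
  also have "\<dots> \<le> (\<Sum>i=1..d. p x i *
     (if s i x = z then visit p z k (L + M) z else visit p z (Suc k) (L + M) (s i x)))"
  proof (intro sum_mono mult_left_mono)
    fix i assume i: "i \<in> {1..d}"
    show "0 \<le> p x i" using assms(1) Suc.prems i by (auto simp: environment_def)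
    show "(if s i x = z then 1 else visit p z 1 L (s i x)) * visit p z k M z \<le>
      (if s i x = z then visit p z k (L + M) z else visit p z (Suc k) (L + M) (s i x))"
      using Suc.IH[of "s i x"] Suc.prems i visit_mono[OF assms(1,2,2), of M "L + M" k] by auto
  qed
  also have "\<dots> = visit p z (Suc k) (Suc L + M) x" by simp
  finally show ?case .
qed

text \<open>
  Almost sure return implies almost surely infinitely many returns, by \<open>visit_mult_le\<close> along
  \<open>L + L\<close>.
\<close>

lemma visit_tendsto_1:
  assumes p: "environment p" and z: "z \<in> V" and lim: "(\<lambda>L. visit p z 1 L z) \<longlonglongrightarrow> 1"
  shows "(\<lambda>L. visit p z k L z) \<longlonglongrightarrow> 1"
proof (induction k)
  case (Suc k)
  \<comment> \<open>The return may take the first half of the time, the other \<open>k\<close> visits the second half.\<close>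
  have sub: "(\<lambda>L. visit p z (Suc k) (L + L) z) \<longlonglongrightarrow> 1"
  proof (rule tendsto_sandwich[where f = "\<lambda>L. visit p z 1 L z * visit p z k L z" and h = "\<lambda>_. 1"])
    show "(\<lambda>L. visit p z 1 L z * visit p z k L z) \<longlonglongrightarrow> 1"
      using tendsto_mult[OF lim Suc] by simp
    show "\<forall>\<^sub>F L in sequentially. visit p z 1 L z * visit p z k L z \<le> visit p z (Suc k) (L + L) z"
      by (intro always_eventually allI visit_mult_le[OF p z z])
    show "\<forall>\<^sub>F L in sequentially. visit p z (Suc k) (L + L) z \<le> 1"
      by (intro always_eventually allI visit_bounds(2)[OF p z z])
  qed simp
  have inc: "incseq (\<lambda>L. visit p z (Suc k) L z)"
    using visit_mono[OF p z z] by (auto simp: incseq_def)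
  obtain l where l: "(\<lambda>L. visit p z (Suc k) L z) \<longlonglongrightarrow> l"
  proof (rule incseq_convergent[OF inc])
    show "\<forall>L. visit p z (Suc k) L z \<le> 1" by (intro allI visit_bounds(2)[OF p z z])
  qed
  have "(\<lambda>L. visit p z (Suc k) (L + L) z) \<longlonglongrightarrow> l"
    using LIMSEQ_subseq_LIMSEQ[OF l, of "\<lambda>L. L + L"] by (simp add: strict_mono_def o_def)
  then have "l = 1" using sub by (rule LIMSEQ_unique)
  with l show ?case by simp
qed simp

text \<open>
  The trails are stopped at the \<open>k\<close>-th visit, so they describe disjoint events. If \<open>k = 0\<close> the only
  such trail is the empty one, which requires \<open>x = z\<close>.
\<close>

lemma visit_eq_sum_trails:
  assumes "x = z \<or> k > 0"
  shows "visit p z k L x = (\<Sum>es\<in>trails z x z k L. trail_weight p es)"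
  using assms
proof (induction L arbitrary: x k)
  case 0
  show ?case
  proof (cases k)
    case k: 0
    then have "trails z x z k 0 = {[]}" using 0 by (auto simp: trails_def)
    then show ?thesis using k by simp
  next
    case (Suc k')
    then have "trails z x z k 0 = {}" by (auto simp: trails_def)
    then show ?thesis using Suc by simp
  qed
next
  case (Suc L)
  show ?case
  proof (cases k)
    case 0
    have "trails z z z 0 (Suc L) = {[]}"
    proof (intro Set.set_eqI iffI)
      fix es assume es: "es \<in> trails z z z 0 (Suc L)"
      then show "es \<in> {[]}"
        by (cases es rule: rev_cases) (auto simp: trails_def trail_snoc)
    qed (auto simp: trails_def)
    then show ?thesis using 0 Suc.prems by simp
  next
    case (Suc k')
    have "(\<Sum>es\<in>trails z x z k (Suc L). trail_weight p es) =
      (\<Sum>i=1..d. \<Sum>es\<in>trails z (s i x) z (if s i x = z then k - 1 else k) L. trail_weight p ((x, i) # es))"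
      unfolding trails_Cons[of k z x L, unfolded Suc, OF zero_less_Suc, folded Suc]
      by (rule sum_Cons_edges) simp
    also have "\<dots> = (\<Sum>i=1..d. p x i * visit p z (if s i x = z then k - 1 else k) L (s i x))"
      using Suc by (intro sum.cong refl) (subst Suc.IH, auto simp: sum_distrib_left)
    also have "\<dots> = visit p z k (Suc L) x"
      unfolding Suc visit.simps by (intro sum.cong refl) auto
    finally show ?thesis ..
  qed
qed

text \<open>
  The trajectory along a trail in the form in which \<open>emeasure_markov_law_cylinder\<close> expects it,
  continued as a constant after the end.
\<close>

fun walk_along :: "'a \<Rightarrow> ('a \<times> nat) list \<Rightarrow> nat \<Rightarrow> 'a" where
  "walk_along x [] n = x"
| "walk_along x (e # es) 0 = x"
| "walk_along x (e # es) (Suc n) = walk_along (head e) es n"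

lemma walk_along_0 [simp]: "walk_along x es 0 = x"
  by (cases es) auto

definition walks :: "'a \<Rightarrow> nat \<Rightarrow> ('a \<times> nat) list set" where
  "walks x n = {es. (\<exists>y. trail x es y) \<and> length es = n}"

lemma finite_walks [simp]: "finite (walks x n)"
  unfolding walks_def by (rule finite_trails_from)

lemma walks_0: "walks x 0 = {[]}"
  by (auto simp: walks_def)

lemma walks_Suc: "walks x (Suc n) = (\<Union>i\<in>{1..d}. Cons (x, i) ` walks (s i x) n)"
  by (auto simp: walks_def length_Suc_conv image_iff)

lemma sum_walks_trail_weight:
  assumes "environment p" "x \<in> V"
  shows "(\<Sum>es\<in>walks x n. trail_weight p es) = 1"
  using assms(2)
proof (induction n arbitrary: x)
  case (Suc n)
  have "(\<Sum>es\<in>walks x (Suc n). trail_weight p es) =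
      (\<Sum>i=1..d. \<Sum>es\<in>walks (s i x) n. trail_weight p ((x, i) # es))"
    unfolding walks_Suc by (rule sum_Cons_edges) simp
  also have "\<dots> = (\<Sum>i=1..d. p x i)"
    using Suc by (intro sum.cong) (simp_all add: sum_distrib_left[symmetric])
  also have "\<dots> = 1" using assms(1) Suc.prems by (auto simp: environment_def)
  finally show ?case .
qed (simp add: walks_0)

lemma sum_hitting_walks:
  assumes "environment p" "x \<in> V"
  shows "(\<Sum>es\<in>{es\<in>walks x n. \<exists>j\<in>{1..n}. walk_along x es j = z}. trail_weight p es) = visit p z 1 n x"
  using assms(2)
proof (induction n arbitrary: x)
  case (Suc n)
  let ?H = "\<lambda>i. if s i x = z then walks (s i x) n
    else {es\<in>walks (s i x) n. \<exists>j\<in>{1..n}. walk_along (s i x) es j = z}"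
  have ex: "(\<exists>j\<in>{1..Suc n}. walk_along x (e # es) j = z) \<longleftrightarrow>
     head e = z \<or> (\<exists>j\<in>{1..n}. walk_along (head e) es j = z)" for e es
  proof -
    have "(\<exists>j\<in>{1..Suc n}. P j) \<longleftrightarrow> P 1 \<or> (\<exists>j\<in>{1..n}. P (Suc j))" for P
    proof (intro iffI; elim bexE disjE)
      fix j assume "j \<in> {1..Suc n}" "P j"
      then show "P 1 \<or> (\<exists>j\<in>{1..n}. P (Suc j))" by (cases j; cases "j = 1") auto
    next
      assume "P 1" then show "\<exists>j\<in>{1..Suc n}. P j" by (intro bexI[of _ 1]) auto
    next
      fix j assume "j \<in> {1..n}" "P (Suc j)"
      then show "\<exists>j\<in>{1..Suc n}. P j" by (intro bexI[of _ "Suc j"]) auto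
    qed
    from this[of "\<lambda>j. walk_along x (e # es) j = z"] show ?thesis by simp
  qed
  have "{es\<in>walks x (Suc n). \<exists>j\<in>{1..Suc n}. walk_along x es j = z} = (\<Union>i\<in>{1..d}. Cons (x, i) ` ?H i)"
  proof (rule Set.set_eqI)
    fix fs
    show "fs \<in> {es\<in>walks x (Suc n). \<exists>j\<in>{1..Suc n}. walk_along x es j = z} \<longleftrightarrow>
      fs \<in> (\<Union>i\<in>{1..d}. Cons (x, i) ` ?H i)"
    proof (cases fs)
      case Nil
      then show ?thesis by (auto simp: walks_def)
    next
      case (Cons e es)
      have "e # es \<in> walks x (Suc n) \<longleftrightarrow> fst e = x \<and> snd e \<in> {1..d} \<and> es \<in> walks (head e) n"
        by (auto simp: walks_def)
      then show ?thesis
        unfolding mem_Collect_eq Cons ex by (cases e; cases "head e = z") (auto simp: image_iff)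
    qed
  qed
  then have "(\<Sum>es\<in>{es\<in>walks x (Suc n). \<exists>j\<in>{1..Suc n}. walk_along x es j = z}. trail_weight p es) =
     (\<Sum>i=1..d. \<Sum>es\<in>?H i. trail_weight p ((x, i) # es))"
    by (simp only:) (rule sum_Cons_edges, simp)
  also have "\<dots> = (\<Sum>i=1..d. p x i * (if s i x = z then visit p z 0 n z else visit p z 1 n (s i x)))"
  proof (intro sum.cong refl)
    fix i assume i: "i \<in> {1..d}"
    show "(\<Sum>es\<in>?H i. trail_weight p ((x, i) # es)) =
       p x i * (if s i x = z then visit p z 0 n z else visit p z 1 n (s i x))"
      using Suc.IH[of "s i x"] sum_walks_trail_weight[OF assms(1), of "s i x" n] i Suc.prems
      by (auto simp: sum_distrib_left[symmetric])
  qed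
  also have "\<dots> = visit p z 1 (Suc n) x" unfolding One_nat_def visit.simps(3) ..
  finally show ?case .
qed simp

lemma walk_along_inj:
  assumes "x \<in> V" "es \<in> walks x n" "es' \<in> walks x n" "\<And>j. j \<le> n \<Longrightarrow> walk_along x es j = walk_along x es' j"
  shows "es = es'"
  using assms
proof (induction n arbitrary: x es es')
  case (Suc n)
  from Suc.prems(2,3) obtain i i' fs fs' where
    e: "es = (x, i) # fs" "i \<in> {1..d}" "fs \<in> walks (s i x) n"
    and e': "es' = (x, i') # fs'" "i' \<in> {1..d}" "fs' \<in> walks (s i' x) n"
    unfolding walks_Suc by blast
  have "s i x = s i' x" using Suc.prems(4)[of 1] e e' by simp
  then have i: "i = i'" using s_inj[OF Suc.prems(1)] e e' by (auto dest: inj_onD)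
  have "fs = fs'"
  proof (rule Suc.IH)
    show "s i x \<in> V" "fs \<in> walks (s i x) n" "fs' \<in> walks (s i x) n" using e e' i Suc.prems by auto
    fix j assume "j \<le> n"
    then show "walk_along (s i x) fs j = walk_along (s i x) fs' j"
      using Suc.prems(4)[of "Suc j"] e e' i by simp
  qed
  with e e' i show ?case by simp
qed (simp add: walks_0)

lemma sets_markov_law_coordinate:
  fixes K :: "'a \<Rightarrow> 'a pmf"
  shows "{\<omega>. \<omega> j = y} \<in> sets (markov_law K x)"
proof -
  have "(\<lambda>\<omega>. \<omega> j) -` {y} \<inter> space (PiM UNIV (\<lambda>_. count_space UNIV)) \<in>
      sets (PiM UNIV (\<lambda>_::nat. count_space (UNIV :: 'a set)))"
    by (rule measurable_sets[OF measurable_component_singleton]) auto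
  then show ?thesis by (simp add: sets_markov_law space_PiM vimage_def)
qed

lemma emeasure_markov_law_walk:
  assumes p: "environment p" and x: "x \<in> V" and es: "es \<in> walks x n"
    and K: "\<And>y i. y \<in> V \<Longrightarrow> i \<in> {1..d} \<Longrightarrow> pmf (K y) (s i y) = p y i"
  shows "emeasure (markov_law K x) {\<omega>. \<forall>j\<le>n. \<omega> j = walk_along x es j} = ennreal (trail_weight p es)"
proof -
  have "(\<Prod>j<n. ennreal (pmf (K (walk_along x es j)) (walk_along x es (Suc j)))) = ennreal (trail_weight p es)"
    using x es
  proof (induction n arbitrary: x es)
    case (Suc n)
    from Suc.prems(2) obtain i fs where
      e: "es = (x, i) # fs" "i \<in> {1..d}" "fs \<in> walks (s i x) n" unfolding walks_Suc by blast
    have "(\<Prod>j<Suc n. ennreal (pmf (K (walk_along x es j)) (walk_along x es (Suc j)))) =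
      ennreal (p x i) * ennreal (trail_weight p fs)"
      unfolding prod.lessThan_Suc_shift using Suc.IH[of "s i x" fs] Suc.prems e by (simp add: K)
    then show ?case
      using e p Suc.prems by (simp add: ennreal_mult' environment_def)
  qed (simp add: walks_0)
  then show ?thesis
    by (simp add: emeasure_markov_law_cylinder)
qed

text \<open>
  Only cylinders are known explicitly. Those along the walks of length \<open>n\<close> are disjoint and have total
  mass \<open>1\<close>, so the lower bounds that they give for the event and for its complement are both sharp.
\<close>

lemma measure_markov_law_hits:
  assumes p: "environment p" and x: "x \<in> V"
    and K: "\<And>y i. y \<in> V \<Longrightarrow> i \<in> {1..d} \<Longrightarrow> pmf (K y) (s i y) = p y i"
  shows "measure (markov_law K x) {\<omega>. \<exists>j\<in>{1..n}. \<omega> j = z} = visit p z 1 n x"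
proof -
  interpret prob_space "markov_law K x" by (rule prob_space_markov_law)
  let ?M = "markov_law K x"
  define E where "E = {\<omega> :: nat \<Rightarrow> 'a. \<exists>j\<in>{1..n}. \<omega> j = z}"
  define cyl where "cyl es = {\<omega>. \<forall>j\<le>n. \<omega> j = walk_along x es j}" for es
  define H where "H = {es\<in>walks x n. \<exists>j\<in>{1..n}. walk_along x es j = z}"
  note comp = sets_markov_law_coordinate[of _ _ K x]
  have E: "E \<in> sets ?M"
  proof -
    have "E = (\<Union>j\<in>{1..n}. {\<omega>. \<omega> j = z})" by (auto simp: E_def)
    then show ?thesis using comp by (auto intro!: sets.finite_UN)
  qed
  have cyl: "cyl es \<in> sets ?M" for es
  proof -
    have "cyl es = (\<Inter>j\<in>{..n}. {\<omega>. \<omega> j = walk_along x es j})" by (auto simp: cyl_def)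
    then show ?thesis using comp by (auto intro!: sets.finite_INT)
  qed
  have disj: "disjoint_family_on cyl (walks x n)"
    unfolding disjoint_family_on_def
  proof (intro ballI impI)
    fix es es' assume a: "es \<in> walks x n" "es' \<in> walks x n" "es \<noteq> es'"
    then obtain j where "j \<le> n" "walk_along x es j \<noteq> walk_along x es' j"
      using walk_along_inj[OF x a(1,2)] by blast
    then show "cyl es \<inter> cyl es' = {}" by (force simp: cyl_def)
  qed
  have w: "prob (cyl es) = trail_weight p es" if "es \<in> walks x n" for es
  proof -
    have "trail_weight p es \<ge> 0"
      using that x by (intro trail_weight_nonneg[OF p]) (auto simp: walks_def dest!: trail_in(2))
    then show ?thesis
      using emeasure_markov_law_walk[OF p x that K] by (simp add: cyl_def measure_def)
  qed
  have part: "(\<Sum>es\<in>A. trail_weight p es) = prob (\<Union>es\<in>A. cyl es)" if "A \<subseteq> walks x n" for A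
  proof -
    have "prob (\<Union>es\<in>A. cyl es) = (\<Sum>es\<in>A. prob (cyl es))"
      using that cyl disj
      by (intro finite_measure_finite_Union) (auto intro: finite_subset[OF _ finite_walks] disjoint_family_on_mono)
    then show ?thesis using w that by (simp add: subset_eq)
  qed
  have "(\<Sum>es\<in>H. trail_weight p es) \<le> prob E"
  proof -
    have "(\<Sum>es\<in>H. trail_weight p es) = prob (\<Union>es\<in>H. cyl es)"
      by (rule part) (auto simp: H_def)
    also have "\<dots> \<le> prob E"
      by (intro finite_measure_mono E) (force simp: H_def cyl_def E_def)
    finally show ?thesis .
  qed
  moreover have "(\<Sum>es\<in>walks x n - H. trail_weight p es) \<le> prob (space ?M - E)"
  proof -
    have "(\<Sum>es\<in>walks x n - H. trail_weight p es) = prob (\<Union>es\<in>walks x n - H. cyl es)"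
      by (rule part) auto
    also have "\<dots> \<le> prob (space ?M - E)"
      by (intro finite_measure_mono sets.compl_sets E) (force simp: H_def cyl_def E_def space_markov_law)
    finally show ?thesis .
  qed
  moreover have "(\<Sum>es\<in>H. trail_weight p es) + (\<Sum>es\<in>walks x n - H. trail_weight p es) = 1"
    unfolding sum_walks_trail_weight[OF p x, of n, symmetric]
    by (subst sum.subset_diff[of H]) (auto simp: H_def)
  ultimately have "(\<Sum>es\<in>H. trail_weight p es) = prob E"
    using prob_compl[OF E] by linarith
  then show ?thesis
    using sum_hitting_walks[OF p x, of n z] by (simp add: H_def E_def)
qed

lemma visit_tendsto_return_probability:
  assumes p: "environment p" and x: "x \<in> V"
    and K: "\<And>y i. y \<in> V \<Longrightarrow> i \<in> {1..d} \<Longrightarrow> pmf (K y) (s i y) = p y i"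
  shows "(\<lambda>n. visit p z 1 n x) \<longlonglongrightarrow> measure (markov_law K x) {\<omega>. \<exists>n\<ge>1. \<omega> n = z}"
proof -
  interpret prob_space "markov_law K x" by (rule prob_space_markov_law)
  let ?E = "\<lambda>n. {\<omega> :: nat \<Rightarrow> 'a. \<exists>j\<in>{1..n}. \<omega> j = z}"
  have sets: "?E n \<in> events" for n
  proof -
    have "(\<Union>j\<in>{1..n}. {\<omega>. \<omega> j = z}) \<in> events"
      using sets_markov_law_coordinate by (intro sets.finite_UN) auto
    also have "(\<Union>j\<in>{1..n}. {\<omega>. \<omega> j = z}) = ?E n" by auto
    finally show ?thesis .
  qed
  have "(\<lambda>n. prob (?E n)) \<longlonglongrightarrow> prob (\<Union>n. ?E n)"
    using sets by (intro finite_Lim_measure_incseq) (auto simp: incseq_def)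
  also have "(\<Union>n. ?E n) = {\<omega>. \<exists>n\<ge>1. \<omega> n = z}"
  proof (intro equalityI subsetI)
    fix \<omega> :: "nat \<Rightarrow> 'a" assume "\<omega> \<in> {\<omega>. \<exists>n\<ge>1. \<omega> n = z}"
    then obtain n where "n \<ge> 1" "\<omega> n = z" by auto
    then have "\<omega> \<in> ?E n" by (intro CollectI bexI[of _ n]) auto
    then show "\<omega> \<in> (\<Union>n. ?E n)" by blast
  qed auto
  finally show ?thesis
    by (simp only: measure_markov_law_hits[OF p x K])
qed

section \<open>A flow of finite energy\<close>

lemma finite_support_visit:
  "finite {x\<in>V. visit p z 1 n x \<noteq> 0}"
proof (induction n)
  case (Suc n)
  have "{x\<in>V. visit p z 1 (Suc n) x \<noteq> 0} \<subseteq>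
      (\<Union>i\<in>{1..d}. r i ` insert z {x\<in>V. visit p z 1 n x \<noteq> 0})"
  proof
    fix x assume x: "x \<in> {x\<in>V. visit p z 1 (Suc n) x \<noteq> 0}"
    then have "(\<Sum>i=1..d. p x i * (if s i x = z then 1 else visit p z 1 n (s i x))) \<noteq> 0"
      unfolding One_nat_def mem_Collect_eq visit.simps by simp
    then obtain i where i: "i \<in> {1..d}" "(if s i x = z then 1 else visit p z 1 n (s i x)) \<noteq> 0"
      by (force dest: sum.not_neutral_contains_not_neutral)
    then have "s i x \<in> insert z {x\<in>V. visit p z 1 n x \<noteq> 0}"
      using x by (auto split: if_splits)
    moreover have "x = r i (s i x)" using x i by simp
    ultimately show "x \<in> (\<Union>i\<in>{1..d}. r i ` insert z {x\<in>V. visit p z 1 n x \<noteq> 0})"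
      using i(1) by blast
  qed
  then show ?case by (rule finite_subset) (use Suc in auto)
qed simp

text \<open>
  Summation by parts: the sums over \<open>x\<close> and over \<open>s i x\<close> agree because \<open>s i\<close> is a permutation. Up to
  normalisation, the right-hand side is the scalar product of \<open>v\<close> with its Laplacian.
\<close>

lemma sum_squared_differences_le:
  fixes v :: "'a \<Rightarrow> real"
  assumes B: "finite B" "B \<subseteq> V" "\<And>x. x \<in> V \<Longrightarrow> x \<notin> B \<Longrightarrow> v x = 0"
    and A: "finite A" "A \<subseteq> V"
  shows "(\<Sum>x\<in>A. \<Sum>i=1..d. (v x - v (s i x))\<^sup>2) \<le> 2 * (\<Sum>x\<in>B. v x * (\<Sum>i=1..d. v x - v (s i x)))"
proof -
  have *: "(\<Sum>x\<in>A \<union> B. (v x - v (s i x))\<^sup>2) \<le> 2 * (\<Sum>x\<in>B. v x * (v x - v (s i x)))"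
    if i: "i \<in> {1..d}" for i
  proof -
    have inj: "inj_on (s i) (A \<union> B)"
      by (rule inj_on_inverseI[of _ "r i"]) (use A B i in auto)
    have "(\<Sum>x\<in>A \<union> B. (v x - v (s i x))\<^sup>2) =
        (\<Sum>x\<in>A \<union> B. (v x)\<^sup>2) + (\<Sum>x\<in>A \<union> B. (v (s i x))\<^sup>2) - 2 * (\<Sum>x\<in>A \<union> B. v x * v (s i x))"
      by (simp add: power2_diff sum.distrib sum_subtractf sum_distrib_left mult.assoc)
    also have "(\<Sum>x\<in>A \<union> B. (v x)\<^sup>2) = (\<Sum>x\<in>B. (v x)\<^sup>2)"
      using A B by (intro sum.mono_neutral_right) auto
    also have "(\<Sum>x\<in>A \<union> B. v x * v (s i x)) = (\<Sum>x\<in>B. v x * v (s i x))"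
      using A B by (intro sum.mono_neutral_right) auto
    also have "(\<Sum>x\<in>A \<union> B. (v (s i x))\<^sup>2) \<le> (\<Sum>x\<in>B. (v x)\<^sup>2)"
    proof -
      have "(\<Sum>x\<in>A \<union> B. (v (s i x))\<^sup>2) = (\<Sum>x\<in>s i ` (A \<union> B). (v x)\<^sup>2)"
        by (subst sum.reindex[OF inj]) simp
      also have "\<dots> = (\<Sum>x\<in>s i ` (A \<union> B) \<inter> B. (v x)\<^sup>2)"
      proof (intro sum.mono_neutral_right ballI)
        fix x assume x: "x \<in> s i ` (A \<union> B) - s i ` (A \<union> B) \<inter> B"
        then have "x \<in> V" "x \<notin> B" using A B i by auto
        then show "(v x)\<^sup>2 = 0" using B(3) by simp
      qed (use A B in auto)
      also have "\<dots> \<le> (\<Sum>x\<in>B. (v x)\<^sup>2)"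
        using B by (intro sum_mono2) auto
      finally show ?thesis .
    qed
    finally show ?thesis
      by (simp add: algebra_simps sum_subtractf power2_eq_square)
  qed
  have "(\<Sum>x\<in>A. \<Sum>i=1..d. (v x - v (s i x))\<^sup>2) \<le> (\<Sum>x\<in>A \<union> B. \<Sum>i=1..d. (v x - v (s i x))\<^sup>2)"
    using A B by (intro sum_mono2) (auto intro: sum_nonneg)
  also have "\<dots> = (\<Sum>i=1..d. \<Sum>x\<in>A \<union> B. (v x - v (s i x))\<^sup>2)" by (rule sum.swap)
  also have "\<dots> \<le> (\<Sum>i=1..d. 2 * (\<Sum>x\<in>B. v x * (v x - v (s i x))))"
    by (intro sum_mono *)
  also have "\<dots> = 2 * (\<Sum>x\<in>B. v x * (\<Sum>i=1..d. v x - v (s i x)))"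
    unfolding sum_distrib_left by (rule sum.swap)
  finally show ?thesis .
qed

text \<open>
  Let \<open>u x\<close> be the probability that the simple random walk from \<open>x\<close> ever visits \<open>z\<close>, with \<open>u z = 1\<close>.
  It is harmonic except at \<open>z\<close>, where the defect \<open>1 - F\<close> is the escape probability, so the positive
  part of its gradient is a flow out of \<open>z\<close>. Its energy is estimated through the finitely supported
  approximations \<open>v n\<close> with \<open>n\<close> steps: they increase with \<open>n\<close>, so away from \<open>z\<close> they lie below the
  average over their neighbours, and the summation by parts in \<open>sum_squared_differences_le\<close>
  leaves at most the term at \<open>z\<close>.
\<close>

lemma finite_energy_flow:
  fixes \<iota> :: "nat \<Rightarrow> nat"
  assumes bij: "bij_betw \<iota> {1..d} {1..d}"
    and sym: "\<forall>i\<in>{1..d}. \<forall>x\<in>V. s (\<iota> i) x = r i x"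
    and z: "z \<in> V" and F: "(\<lambda>n. visit (\<lambda>_ _. 1 / real d) z 1 n z) \<longlonglongrightarrow> F" "F < 1"
  shows "\<exists>(\<theta> :: 'a \<Rightarrow> nat \<Rightarrow> real) \<gamma> :: real. \<gamma> > 0 \<and>
    (\<forall>x\<in>V. \<forall>i\<in>{1..d}. 0 \<le> \<theta> x i \<and> \<theta> x i \<le> 1) \<and>
    (\<forall>x\<in>V. (\<Sum>i=1..d. \<theta> x i) = (\<Sum>i=1..d. \<theta> (r i x) i) + (if x = z then \<gamma> else 0)) \<and>
    (\<forall>A. finite A \<longrightarrow> A \<subseteq> V \<longrightarrow> (\<Sum>x\<in>A. \<Sum>i=1..d. (\<theta> x i)\<^sup>2) \<le> 2 * real d)"
proof -
  define p :: "'a \<Rightarrow> nat \<Rightarrow> real" where "p = (\<lambda>_ _. 1 / real d)"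
  define h where "h n x = visit p z 1 n x" for n x
  define v where "v n x = (if x = z then 1 else h n x)" for n x
  have env: "environment p" using d_pos by (simp add: environment_def p_def)
  have h01: "0 \<le> h n x" "h n x \<le> 1" if "x \<in> V" for n x
    unfolding h_def using visit_bounds[OF env z that] by auto
  have h_Suc: "real d * h (Suc n) x = (\<Sum>i=1..d. v n (s i x))" for n x
    unfolding h_def v_def One_nat_def visit.simps p_def
    using d_pos by (simp add: sum_distrib_left)
  have hmono: "h n x \<le> h (Suc n) x" if "x \<in> V" for n x
    unfolding h_def by (rule visit_Suc_mono[OF env z that])
  have "\<exists>l. (\<lambda>n. h n x) \<longlonglongrightarrow> l" if "x \<in> V" for x
  proof -
    have "incseq (\<lambda>n. h n x)" by (rule incseq_SucI) (rule hmono[OF that])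
    then show ?thesis
      using incseq_convergent[of "\<lambda>n. h n x" 1] h01(2)[OF that] by blast
  qed
  then obtain hl where hl: "\<And>x. x \<in> V \<Longrightarrow> (\<lambda>n. h n x) \<longlonglongrightarrow> hl x" by metis
  define u where "u x = (if x = z then 1 else hl x)" for x
  have vu: "(\<lambda>n. v n x) \<longlonglongrightarrow> u x" if "x \<in> V" for x
    using hl[OF that] by (auto simp: v_def u_def)
  have v01: "0 \<le> v n x" "v n x \<le> 1" if "x \<in> V" for n x
    using h01[OF that] by (auto simp: v_def)
  have u01: "0 \<le> u x" "u x \<le> 1" if "x \<in> V" for x
    using LIMSEQ_le_const[OF vu[OF that], of 0] LIMSEQ_le_const2[OF vu[OF that], of 1] v01[OF that] by auto
  have hlz: "hl z = F"
    using LIMSEQ_unique[OF hl[OF z]] F(1) by (simp add: h_def p_def)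
  have harm: "(\<Sum>i=1..d. u (s i x)) = real d * hl x" if x: "x \<in> V" for x
  proof (rule LIMSEQ_unique)
    show "(\<lambda>n. \<Sum>i=1..d. v n (s i x)) \<longlonglongrightarrow> (\<Sum>i=1..d. u (s i x))"
      using x by (intro tendsto_sum vu) auto
    show "(\<lambda>n. \<Sum>i=1..d. v n (s i x)) \<longlonglongrightarrow> real d * hl x"
      unfolding h_Suc[symmetric] using LIMSEQ_Suc[OF hl[OF x]] by (intro tendsto_mult tendsto_const)
  qed
  \<comment> \<open>Orienting the gradient: an edge and its inverse edge never both carry flow.\<close>
  define \<theta> where "\<theta> x i = max 0 (u x - u (s i x))" for x i
  define \<gamma> where "\<gamma> = real d * (1 - F)"
  show ?thesis
  proof (intro exI[of _ \<theta>] exI[of _ \<gamma>] conjI ballI allI impI)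
    show "\<gamma> > 0" using F(2) d_pos by (simp add: \<gamma>_def)
    show "0 \<le> \<theta> x i" "\<theta> x i \<le> 1" if "x \<in> V" "i \<in> {1..d}" for x i
      using u01[OF that(1)] u01[OF s_in[OF that(2,1)]] by (auto simp: \<theta>_def)
    show "(\<Sum>i=1..d. \<theta> x i) = (\<Sum>i=1..d. \<theta> (r i x) i) + (if x = z then \<gamma> else 0)" if x: "x \<in> V" for x
    proof -
      have "(\<Sum>i=1..d. \<theta> (r i x) i) = (\<Sum>i=1..d. max 0 (u (s (\<iota> i) x) - u x))"
        using x by (intro sum.cong) (auto simp: \<theta>_def sym)
      also have "\<dots> = (\<Sum>i=1..d. max 0 (u (s i x) - u x))"
        by (rule sum.reindex_bij_betw[OF bij])
      finally have "(\<Sum>i=1..d. \<theta> x i) - (\<Sum>i=1..d. \<theta> (r i x) i) =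
          (\<Sum>i=1..d. max 0 (u x - u (s i x)) - max 0 (u (s i x) - u x))"
        by (simp add: \<theta>_def sum_subtractf)
      also have "\<dots> = (\<Sum>i=1..d. u x - u (s i x))"
        by (intro sum.cong) auto
      also have "\<dots> = real d * (u x - hl x)"
        using harm[OF x] by (simp add: sum_subtractf algebra_simps)
      also have "\<dots> = (if x = z then \<gamma> else 0)"
        by (simp add: u_def \<gamma>_def hlz)
      finally show ?thesis by simp
    qed
    fix A assume A: "finite A" "A \<subseteq> V"
    \<comment> \<open>The bound for the approximations; it passes to \<open>u\<close> because \<open>A\<close> is finite.\<close>
    have energy: "(\<Sum>x\<in>A. \<Sum>i=1..d. (v n x - v n (s i x))\<^sup>2) \<le> 2 * real d" for n
    proof -
      define B where "B = insert z {x\<in>V. h n x \<noteq> 0}"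
      have B: "finite B" "B \<subseteq> V" "\<And>x. x \<in> V \<Longrightarrow> x \<notin> B \<Longrightarrow> v n x = 0"
        using finite_support_visit[of p z n] z by (auto simp: B_def v_def h_def)
      have "(\<Sum>x\<in>A. \<Sum>i=1..d. (v n x - v n (s i x))\<^sup>2) \<le>
          2 * (\<Sum>x\<in>B. v n x * (\<Sum>i=1..d. v n x - v n (s i x)))"
        by (rule sum_squared_differences_le[OF B A])
      also have "\<dots> = 2 * (\<Sum>x\<in>B. v n x * (real d * (v n x - h (Suc n) x)))"
      proof -
        have "(\<Sum>i=1..d. v n x - v n (s i x)) = real d * (v n x - h (Suc n) x)" for x
          unfolding right_diff_distrib h_Suc by (simp add: sum_subtractf)
        then show ?thesis by simp
      qed
      also have "\<dots> \<le> 2 * (\<Sum>x\<in>B. if x = z then real d else 0)"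
      proof (intro mult_left_mono sum_mono)
        fix x assume "x \<in> B"
        then have x: "x \<in> V" using B by auto
        show "v n x * (real d * (v n x - h (Suc n) x)) \<le> (if x = z then real d else 0)"
        proof (cases "x = z")
          case True
          then show ?thesis using h01[OF x, of "Suc n"] by (simp add: v_def algebra_simps)
        next
          case False
          then have "v n x - h (Suc n) x \<le> 0" using hmono[OF x, of n] by (simp add: v_def)
          then show ?thesis using False v01[OF x, of n]
            by (auto intro!: mult_nonneg_nonpos)
        qed
      qed simp
      also have "\<dots> = 2 * real d" using B by (simp add: B_def)
      finally show ?thesis .
    qed
    have "(\<Sum>x\<in>A. \<Sum>i=1..d. (\<theta> x i)\<^sup>2) \<le> (\<Sum>x\<in>A. \<Sum>i=1..d. (u x - u (s i x))\<^sup>2)"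
      unfolding \<theta>_def by (intro sum_mono) (auto simp: max_def)
    also have "\<dots> \<le> 2 * real d"
    proof (rule LIMSEQ_le_const2)
      show "(\<lambda>n. \<Sum>x\<in>A. \<Sum>i=1..d. (v n x - v n (s i x))\<^sup>2) \<longlonglongrightarrow> (\<Sum>x\<in>A. \<Sum>i=1..d. (u x - u (s i x))\<^sup>2)"
        using A by (intro tendsto_sum tendsto_power tendsto_diff vu) auto
    qed (use energy in blast)
    finally show "(\<Sum>x\<in>A. \<Sum>i=1..d. (\<theta> x i)\<^sup>2) \<le> 2 * real d" .
  qed
qed

end

section \<open>Moments of the environment\<close>

locale dirichlet_digraph = permutation_digraph +
  fixes \<alpha> :: "nat \<Rightarrow> real"
  assumes \<alpha>_pos: "\<And>i. i \<in> {1..d} \<Longrightarrow> \<alpha> i > 0" and countable_V: "countable V"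
begin

abbreviation env_law :: "('a \<Rightarrow> nat \<Rightarrow> real) measure" where
  "env_law \<equiv> PiM V (\<lambda>_. dirichlet d \<alpha>)"

sublocale env: product_prob_space "\<lambda>_::'a. dirichlet d \<alpha>" V
proof (intro product_prob_space.intro product_prob_space_axioms.intro product_sigma_finite.intro)
  show "prob_space (dirichlet d \<alpha>)" by (rule prob_space_dirichlet[OF d_pos \<alpha>_pos])
  then show "sigma_finite_measure (dirichlet d \<alpha>)" by (rule prob_space_imp_sigma_finite)
qed

lemma AE_env_law:
  "AE p in env_law. \<forall>x\<in>V. (\<forall>i\<in>{1..d}. 0 < p x i) \<and> (\<Sum>i=1..d. p x i) = 1"
proof (rule AE_ball_countable'[OF _ countable_V])
  fix x assume "x \<in> V"
  then show "AE p in env_law. (\<forall>i\<in>{1..d}. 0 < p x i) \<and> (\<Sum>i=1..d. p x i) = 1"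
    by (rule AE_PiM_component[OF env.prob_space _ AE_dirichlet[OF d_pos]])
qed

lemma measurable_env_component [measurable]:
  assumes "x \<in> V" "i \<in> {1..d}"
  shows "(\<lambda>p. p x i) \<in> borel_measurable env_law"
proof -
  have "(\<lambda>q. q i) \<in> borel_measurable (dirichlet d \<alpha>)"
    unfolding measurable_cong_sets[OF sets_dirichlet refl]
    using assms by (intro measurable_component_singleton)
  from measurable_compose[OF measurable_component_singleton[OF assms(1)] this]
  show ?thesis .
qed

lemma nn_integral_env_powr:
  assumes X: "finite X" "X \<subseteq> V" and t: "\<And>x i. x \<in> X \<Longrightarrow> i \<in> {1..d} \<Longrightarrow> \<alpha> i + t x i > 0"
  shows "(\<integral>\<^sup>+p. ennreal (\<Prod>x\<in>X. \<Prod>i=1..d. p x i powr t x i) \<partial>env_law) =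
    ennreal (\<Prod>x\<in>X. dirichlet_moment d \<alpha> (t x))"
proof -
  have m: "(\<lambda>q. ennreal (\<Prod>i=1..d. q i powr t x i)) \<in> borel_measurable (dirichlet d \<alpha>)" for x
    unfolding measurable_cong_sets[OF sets_dirichlet refl] by measurable
  have "(\<integral>\<^sup>+p. ennreal (\<Prod>x\<in>X. \<Prod>i=1..d. p x i powr t x i) \<partial>env_law) =
      (\<integral>\<^sup>+p. (\<Prod>x\<in>X. ennreal (\<Prod>i=1..d. restrict p X x i powr t x i)) \<partial>env_law)"
  proof (rule nn_integral_cong)
    fix p :: "'a \<Rightarrow> nat \<Rightarrow> real"
    have "(\<Prod>x\<in>X. ennreal (\<Prod>i=1..d. restrict p X x i powr t x i)) =
        (\<Prod>x\<in>X. ennreal (\<Prod>i=1..d. p x i powr t x i))"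
      by (intro prod.cong refl) (simp only: restrict_apply if_True)
    also have "\<dots> = ennreal (\<Prod>x\<in>X. \<Prod>i=1..d. p x i powr t x i)"
      by (intro prod_ennreal prod_nonneg powr_ge_zero)
    finally show "ennreal (\<Prod>x\<in>X. \<Prod>i=1..d. p x i powr t x i) =
        (\<Prod>x\<in>X. ennreal (\<Prod>i=1..d. restrict p X x i powr t x i))" ..
  qed
  also have "\<dots> = (\<integral>\<^sup>+p. (\<Prod>x\<in>X. ennreal (\<Prod>i=1..d. p x i powr t x i)) \<partial>PiM X (\<lambda>_. dirichlet d \<alpha>))"
  proof -
    have r: "(\<lambda>p. restrict p X) \<in> env_law \<rightarrow>\<^sub>M PiM X (\<lambda>_. dirichlet d \<alpha>)"
      using X by (intro measurable_restrict_subset)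
    have f: "(\<lambda>p. \<Prod>x\<in>X. ennreal (\<Prod>i=1..d. p x i powr t x i)) \<in> borel_measurable (PiM X (\<lambda>_. dirichlet d \<alpha>))"
    proof (rule borel_measurable_prod_ennreal)
      fix x assume "x \<in> X"
      from measurable_compose[OF measurable_component_singleton[OF this] m]
      show "(\<lambda>p. ennreal (\<Prod>i=1..d. p x i powr t x i)) \<in> borel_measurable (PiM X (\<lambda>_. dirichlet d \<alpha>))" .
    qed
    then have "(\<lambda>p. \<Prod>x\<in>X. ennreal (\<Prod>i=1..d. p x i powr t x i)) \<in>
        borel_measurable (distr env_law (PiM X (\<lambda>_. dirichlet d \<alpha>)) (\<lambda>p. restrict p X))" by simp
    from nn_integral_distr[OF r this] show ?thesis
      unfolding env.distr_PiM_restrict_finite[OF X] by (rule sym)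
  qed
  also have "\<dots> = (\<Prod>x\<in>X. \<integral>\<^sup>+q. ennreal (\<Prod>i=1..d. q i powr t x i) \<partial>dirichlet d \<alpha>)"
    using X m by (intro env.product_nn_integral_prod) auto
  also have "\<dots> = (\<Prod>x\<in>X. ennreal (dirichlet_moment d \<alpha> (t x)))"
    unfolding dirichlet_moment_def
    by (intro prod.cong refl nn_integral_dirichlet_powr d_pos \<alpha>_pos t)
  also have "\<dots> = ennreal (\<Prod>x\<in>X. dirichlet_moment d \<alpha> (t x))"
    using d_pos \<alpha>_pos t by (intro prod_ennreal less_imp_le[OF dirichlet_moment_pos]) auto
  finally show ?thesis .
qed

lemma trail_weight_eq_prod:
  assumes X: "finite X" and es: "set es \<subseteq> X \<times> {1..d}"
  shows "trail_weight p es = (\<Prod>x\<in>X. \<Prod>i=1..d. p x i ^ count (mset es) (x, i))"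
proof -
  have "trail_weight p es = prod_mset (image_mset (\<lambda>(x, i). p x i) (mset es))"
    by (simp add: trail_weight_def prod_mset_prod_list flip: mset_map)
  also have "\<dots> = (\<Prod>e\<in>set es. (case e of (x, i) \<Rightarrow> p x i) ^ count (mset es) e)"
    by (simp add: image_prod_mset_multiplicity)
  also have "\<dots> = (\<Prod>e\<in>X \<times> {1..d}. (case e of (x, i) \<Rightarrow> p x i) ^ count (mset es) e)"
  proof (rule prod.mono_neutral_left)
    show "\<forall>e\<in>X \<times> {1..d} - set es. (case e of (x, i) \<Rightarrow> p x i) ^ count (mset es) e = 1"
    proof
      fix e assume "e \<in> X \<times> {1..d} - set es"
      then have "count (mset es) e = 0" by (metis DiffD2 count_eq_zero_iff set_mset_mset)
      then show "(case e of (x, i) \<Rightarrow> p x i) ^ count (mset es) e = 1" by (simp only: power_0)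
    qed
  qed (use X es in auto)
  also have "\<dots> = (\<Prod>x\<in>X. \<Prod>i=1..d. p x i ^ count (mset es) (x, i))"
    by (simp add: prod.cartesian_product case_prod_beta)
  finally show ?thesis .
qed

lemma count_image_fst:
  assumes "set_mset C \<subseteq> V' \<times> {1..d}"
  shows "count (image_mset fst C) x = (\<Sum>i=1..d. count C (x, i))"
proof -
  have "count (image_mset fst C) x = (\<Sum>e\<in>fst -` {x} \<inter> set_mset C. count C e)"
    by (rule count_image_mset)
  also have "\<dots> = (\<Sum>e\<in>Pair x ` {1..d}. count C e)"
    using assms by (intro sum.mono_neutral_left) (auto simp: not_in_iff)
  also have "\<dots> = (\<Sum>i=1..d. count C (x, i))"
    by (subst sum.reindex) (auto simp: inj_on_def)
  finally show ?thesis .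
qed

lemma measurable_trail_weight:
  assumes "set es \<subseteq> V \<times> {1..d}"
  shows "(\<lambda>p. trail_weight p es) \<in> borel_measurable env_law"
  using assms
proof (induction es)
  case (Cons e es)
  obtain x i where e: "e = (x, i)" by (cases e)
  have [measurable]: "(\<lambda>p. trail_weight p es) \<in> borel_measurable env_law"
    "(\<lambda>p. p x i) \<in> borel_measurable env_law"
    using Cons e measurable_env_component by auto
  show ?case unfolding e trail_weight_simps by measurable
qed simp

lemma measurable_visit:
  assumes "z \<in> V"
  shows "(\<lambda>p. visit p z k L z) \<in> borel_measurable env_law"
  unfolding visit_eq_sum_trails[of z z, OF disjI1[OF refl]]
proof (rule borel_measurable_sum)
  fix es assume "es \<in> trails z z z k L"
  then show "(\<lambda>p. trail_weight p es) \<in> borel_measurable env_law"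
    using trail_in(2)[OF assms] by (intro measurable_trail_weight) (auto simp: trails_def)
qed

text \<open>
  The probability of a trail, averaged over the environments tilted by \<open>p powr \<delta>\<close>. As the
  directions of the jumps from a vertex are drawn from the environment at their tail, the urns at the
  tails of the edges appear here.
\<close>

lemma nn_integral_trail_weight_powr:
  assumes X: "finite X" "X \<subseteq> V" and es: "set es \<subseteq> X \<times> {1..d}"
    and \<delta>: "\<And>x i. x \<in> X \<Longrightarrow> i \<in> {1..d} \<Longrightarrow> \<alpha> i + \<delta> x i > 0"
  shows "(\<integral>\<^sup>+p. ennreal (trail_weight p es * (\<Prod>x\<in>X. \<Prod>i=1..d. p x i powr \<delta> x i)) \<partial>env_law) =
    ennreal ((\<Prod>x\<in>X. dirichlet_moment d \<alpha> (\<delta> x)) *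
      (pochhammer_mset (\<lambda>(x, i). \<alpha> i + \<delta> x i) (mset es) /
       pochhammer_mset (\<lambda>x. \<Sum>i=1..d. \<alpha> i + \<delta> x i) (image_mset fst (mset es))))"
proof -
  let ?n = "\<lambda>x i. count (mset es) (x, i)"
  have "(\<integral>\<^sup>+p. ennreal (trail_weight p es * (\<Prod>x\<in>X. \<Prod>i=1..d. p x i powr \<delta> x i)) \<partial>env_law) =
    (\<integral>\<^sup>+p. ennreal (\<Prod>x\<in>X. \<Prod>i=1..d. p x i powr (\<delta> x i + ?n x i)) \<partial>env_law)"
  proof (rule nn_integral_cong_AE, rule AE_mp[OF AE_env_law], intro AE_I2 impI)
    fix p :: "'a \<Rightarrow> nat \<Rightarrow> real"
    assume p: "\<forall>x\<in>V. (\<forall>i\<in>{1..d}. 0 < p x i) \<and> (\<Sum>i=1..d. p x i) = 1"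
    have "trail_weight p es * (\<Prod>x\<in>X. \<Prod>i=1..d. p x i powr \<delta> x i) =
        (\<Prod>x\<in>X. \<Prod>i=1..d. p x i powr (\<delta> x i + ?n x i))"
      unfolding trail_weight_eq_prod[OF X(1) es] prod.distrib[symmetric]
    proof (intro prod.cong refl)
      fix x i assume xi: "x \<in> X" "i \<in> {1..d}"
      then have "p x i > 0" using p X by auto
      then show "p x i ^ ?n x i * p x i powr \<delta> x i = p x i powr (\<delta> x i + ?n x i)"
        by (simp add: powr_add powr_realpow)
    qed
    then show "ennreal (trail_weight p es * (\<Prod>x\<in>X. \<Prod>i=1..d. p x i powr \<delta> x i)) =
        ennreal (\<Prod>x\<in>X. \<Prod>i=1..d. p x i powr (\<delta> x i + ?n x i))" by simp
  qed
  also have "\<dots> = ennreal (\<Prod>x\<in>X. dirichlet_moment d \<alpha> (\<lambda>i. \<delta> x i + ?n x i))"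
  proof (rule nn_integral_env_powr[OF X])
    fix x i assume "x \<in> X" "i \<in> {1..d}"
    from \<delta>[OF this] show "0 < \<alpha> i + (\<delta> x i + ?n x i)" by simp
  qed
  also have "(\<Prod>x\<in>X. dirichlet_moment d \<alpha> (\<lambda>i. \<delta> x i + ?n x i)) =
     (\<Prod>x\<in>X. dirichlet_moment d \<alpha> (\<delta> x) * ((\<Prod>i=1..d. pochhammer (\<alpha> i + \<delta> x i) (?n x i)) /
        pochhammer (\<Sum>i=1..d. \<alpha> i + \<delta> x i) (\<Sum>i=1..d. ?n x i)))"
    by (intro prod.cong refl dirichlet_moment_add_nat d_pos \<delta>)
  also have "\<dots> = (\<Prod>x\<in>X. dirichlet_moment d \<alpha> (\<delta> x)) *
     ((\<Prod>x\<in>X. \<Prod>i=1..d. pochhammer (\<alpha> i + \<delta> x i) (?n x i)) /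
      (\<Prod>x\<in>X. pochhammer (\<Sum>i=1..d. \<alpha> i + \<delta> x i) (\<Sum>i=1..d. ?n x i)))"
    by (simp only: prod.distrib prod_dividef)
  also have "(\<Prod>x\<in>X. \<Prod>i=1..d. pochhammer (\<alpha> i + \<delta> x i) (?n x i)) =
      pochhammer_mset (\<lambda>(x, i). \<alpha> i + \<delta> x i) (mset es)"
    using X es by (subst pochhammer_mset_superset[of "X \<times> {1..d}"])
      (auto simp: prod.cartesian_product case_prod_beta)
  also have "(\<Prod>x\<in>X. pochhammer (\<Sum>i=1..d. \<alpha> i + \<delta> x i) (\<Sum>i=1..d. ?n x i)) =
      pochhammer_mset (\<lambda>x. \<Sum>i=1..d. \<alpha> i + \<delta> x i) (image_mset fst (mset es))"
  proof -
    have "set_mset (mset es) \<subseteq> X \<times> {1..d}" using es by simp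
    note c = count_image_fst[OF this]
    have "set_mset (image_mset fst (mset es)) \<subseteq> X" using es by auto
    from pochhammer_mset_superset[OF X(1) this] show ?thesis by (simp only: c)
  qed
  finally show ?thesis .
qed

section \<open>Many returns are unlikely\<close>

text \<open>
  Write \<open>W = (W * sqrt P) * sqrt N\<close> for the probability \<open>W\<close> of \<open>k\<close> returns within \<open>L\<close> steps, where
  \<open>P = \<Prod>p powr \<delta>\<close> and \<open>N = 1 / P\<close> are taken over the finitely many vertices in reach. The
  Cauchy-Schwarz inequality and \<open>W\<^sup>2 \<le> W\<close> bound the square of the mean of \<open>W\<close> by the product
  of the means of \<open>W * P\<close> and \<open>N\<close>. The first is a sum of urn weights of closed trails, which
  are read backwards.
\<close>

lemma nn_integral_visit_squared_le:
  fixes \<delta> :: "'a \<Rightarrow> nat \<Rightarrow> real" and \<gamma> E :: real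
  assumes z: "z \<in> V" and \<gamma>: "\<gamma> \<ge> 0"
    and \<delta>: "\<And>x i. x \<in> V \<Longrightarrow> i \<in> {1..d} \<Longrightarrow> 0 \<le> \<delta> x i \<and> \<delta> x i \<le> \<alpha> i / 2"
    and flow: "\<And>x. x \<in> V \<Longrightarrow> (\<Sum>i=1..d. \<delta> x i) = (\<Sum>i=1..d. \<delta> (r i x) i) + (if x = z then \<gamma> else 0)"
    and energy: "\<And>A. finite A \<Longrightarrow> A \<subseteq> V \<Longrightarrow> (\<Sum>x\<in>A. \<Sum>i=1..d. (\<delta> x i)\<^sup>2) \<le> E"
  shows "(\<integral>\<^sup>+p. ennreal (visit p z k L z) \<partial>env_law)\<^sup>2 \<le>
    ennreal (exp ((\<Sum>i=1..d. \<bar>Polygamma 1 (\<alpha> i / 2)\<bar>) * E) *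
      (\<Prod>j<k. 1 - \<gamma> / ((\<Sum>i=1..d. \<alpha> i + \<delta> z i) + real j)))"
proof -
  define C where "C = (\<Sum>i=1..d. \<bar>Polygamma 1 (\<alpha> i / 2)\<bar>)"
  define b where "b x = (\<Sum>i=1..d. \<alpha> i + \<delta> x i)" for x
  define \<beta> where "\<beta> = (\<lambda>(x, i). \<alpha> i + \<delta> x i)"
  define \<pi> where "\<pi> = (\<Prod>j<k. 1 - \<gamma> / (b z + real j))"
  define T where "T = trails z z z k L"
  define X where "X = (\<Union>es\<in>T. fst ` set es)"
  define P where "P p = (\<Prod>x\<in>X. \<Prod>i=1..d. p x i powr \<delta> x i)" for p :: "'a \<Rightarrow> nat \<Rightarrow> real"
  define N where "N p = (\<Prod>x\<in>X. \<Prod>i=1..d. p x i powr - \<delta> x i)" for p :: "'a \<Rightarrow> nat \<Rightarrow> real"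
  define W where "W p = visit p z k L z" for p :: "'a \<Rightarrow> nat \<Rightarrow> real"
  define m where "m = (\<Prod>x\<in>X. dirichlet_moment d \<alpha> (\<delta> x))"
  define m' where "m' = (\<Prod>x\<in>X. dirichlet_moment d \<alpha> (\<lambda>i. - \<delta> x i))"
  have T: "trail z es z" "set es \<subseteq> V \<times> {1..d}" if "es \<in> T" for es
    using that trail_in(2)[OF z] by (auto simp: T_def trails_def)
  have X: "finite X" "X \<subseteq> V"
  proof -
    show "finite X" by (auto simp: X_def T_def)
    show "X \<subseteq> V" unfolding X_def using T(2) by fastforce
  qed
  have esX: "set es \<subseteq> X \<times> {1..d}" if "es \<in> T" for es
    using T(2)[OF that] that by (force simp: X_def)
  have \<delta>p: "\<alpha> i + \<delta> x i > 0" "\<alpha> i + - \<delta> x i > 0" if "x \<in> V" "i \<in> {1..d}" for x i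
    using \<delta>[OF that] \<alpha>_pos[OF that(2)] by auto
  have comp [measurable]: "(\<lambda>p. p x i) \<in> borel_measurable env_law" if "x \<in> X" "i \<in> {1..d}" for x i
    using that X measurable_env_component by auto
  have pw: "(\<lambda>p. p x i powr c) \<in> borel_measurable env_law" if "x \<in> X" "i \<in> {1..d}" for x i c
    using comp[OF that] by measurable
  have [measurable]: "P \<in> borel_measurable env_law" "N \<in> borel_measurable env_law"
    "W \<in> borel_measurable env_law"
    unfolding P_def[abs_def] N_def[abs_def] W_def[abs_def]
    using measurable_visit[OF z] by (auto intro!: borel_measurable_prod pw)
  have Wsum: "W p = (\<Sum>es\<in>T. trail_weight p es)" for p :: "'a \<Rightarrow> nat \<Rightarrow> real"
    unfolding W_def T_def by (rule visit_eq_sum_trails) simp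
  have good: "P p \<ge> 0 \<and> N p \<ge> 0 \<and> P p * N p = 1 \<and> 0 \<le> W p \<and> W p \<le> 1 \<and> (\<forall>es\<in>T. trail_weight p es \<ge> 0)"
    if p: "\<forall>x\<in>V. (\<forall>i\<in>{1..d}. 0 < p x i) \<and> (\<Sum>i=1..d. p x i) = 1" for p :: "'a \<Rightarrow> nat \<Rightarrow> real"
  proof -
    have env: "environment p" using p by (auto simp: environment_def intro: less_imp_le)
    have "P p * N p = (\<Prod>x\<in>X. \<Prod>i=1..d. p x i powr \<delta> x i * p x i powr - \<delta> x i)"
      by (simp add: P_def N_def prod.distrib)
    also have "\<dots> = 1"
    proof (intro prod.neutral ballI)
      fix x i assume "x \<in> X" "i \<in> {1..d}"
      then have "p x i > 0" using p X by auto
      then show "p x i powr \<delta> x i * p x i powr - \<delta> x i = 1" by (simp flip: powr_add)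
    qed
    finally show ?thesis
      using visit_bounds[OF env z z] trail_weight_nonneg[OF env T(2)]
      by (auto simp: P_def N_def W_def intro!: prod_nonneg)
  qed
  have "(\<integral>\<^sup>+p. ennreal (W p) \<partial>env_law) =
      (\<integral>\<^sup>+p. ennreal (W p * sqrt (P p)) * ennreal (sqrt (N p)) \<partial>env_law)"
  proof (rule nn_integral_cong_AE, rule AE_mp[OF AE_env_law], intro AE_I2 impI)
    fix p :: "'a \<Rightarrow> nat \<Rightarrow> real" assume "\<forall>x\<in>V. (\<forall>i\<in>{1..d}. 0 < p x i) \<and> (\<Sum>i=1..d. p x i) = 1"
    note g = good[OF this]
    then have "W p * sqrt (P p) * sqrt (N p) = W p"
      by (simp add: mult.assoc flip: real_sqrt_mult)
    then show "ennreal (W p) = ennreal (W p * sqrt (P p)) * ennreal (sqrt (N p))"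
      using g by (simp flip: ennreal_mult'')
  qed
  then have "(\<integral>\<^sup>+p. ennreal (W p) \<partial>env_law)\<^sup>2 \<le>
     (\<integral>\<^sup>+p. (ennreal (W p * sqrt (P p)))\<^sup>2 \<partial>env_law) * (\<integral>\<^sup>+p. (ennreal (sqrt (N p)))\<^sup>2 \<partial>env_law)"
    using Cauchy_Schwarz_nn_integral[of "\<lambda>p. ennreal (W p * sqrt (P p))" env_law "\<lambda>p. ennreal (sqrt (N p))"]
    by simp
  also have "(\<integral>\<^sup>+p. (ennreal (sqrt (N p)))\<^sup>2 \<partial>env_law) = ennreal m'"
  proof -
    have "(\<integral>\<^sup>+p. (ennreal (sqrt (N p)))\<^sup>2 \<partial>env_law) = (\<integral>\<^sup>+p. ennreal (N p) \<partial>env_law)"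
    proof (rule nn_integral_cong)
      fix p
      have "N p \<ge> 0" by (auto simp: N_def intro!: prod_nonneg)
      then show "(ennreal (sqrt (N p)))\<^sup>2 = ennreal (N p)" by (simp add: ennreal_power)
    qed
    also have "\<dots> = ennreal m'"
      unfolding N_def m'_def using X \<delta>p(2) by (intro nn_integral_env_powr) auto
    finally show ?thesis .
  qed
  also have "(\<integral>\<^sup>+p. (ennreal (W p * sqrt (P p)))\<^sup>2 \<partial>env_law) \<le> ennreal (m * \<pi>)"
  proof -
    have "(\<integral>\<^sup>+p. (ennreal (W p * sqrt (P p)))\<^sup>2 \<partial>env_law) \<le>
        (\<integral>\<^sup>+p. (\<Sum>es\<in>T. ennreal (trail_weight p es * P p)) \<partial>env_law)"
    proof (rule nn_integral_mono_AE, rule AE_mp[OF AE_env_law], intro AE_I2 impI)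
      fix p :: "'a \<Rightarrow> nat \<Rightarrow> real" assume "\<forall>x\<in>V. (\<forall>i\<in>{1..d}. 0 < p x i) \<and> (\<Sum>i=1..d. p x i) = 1"
      note g = good[OF this]
      then have "(ennreal (W p * sqrt (P p)))\<^sup>2 = ennreal ((W p)\<^sup>2 * P p)"
        by (simp add: ennreal_power power_mult_distrib)
      also have "\<dots> \<le> ennreal (W p * P p)"
        using g by (intro ennreal_leI mult_right_mono) (auto simp: power2_eq_square mult_left_le)
      also have "\<dots> = (\<Sum>es\<in>T. ennreal (trail_weight p es * P p))"
        using g by (subst sum_ennreal) (auto simp: Wsum sum_distrib_right)
      finally show "(ennreal (W p * sqrt (P p)))\<^sup>2 \<le> (\<Sum>es\<in>T. ennreal (trail_weight p es * P p))" .
    qed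
    also have "\<dots> = (\<Sum>es\<in>T. \<integral>\<^sup>+p. ennreal (trail_weight p es * P p) \<partial>env_law)"
    proof (rule nn_integral_sum)
      fix es assume "es \<in> T"
      note [measurable] = measurable_trail_weight[OF T(2)[OF this]]
      show "(\<lambda>p. ennreal (trail_weight p es * P p)) \<in> borel_measurable env_law" by measurable
    qed
    also have "\<dots> = (\<Sum>es\<in>T. ennreal (m * urn_weight \<beta> b (mset es)))"
    proof (rule sum.cong[OF refl])
      fix es assume es: "es \<in> T"
      have "image_mset head (mset es) = image_mset fst (mset es)"
        using trail_balanced[OF T(1)[OF es]] by simp
      then show "(\<integral>\<^sup>+p. ennreal (trail_weight p es * P p) \<partial>env_law) = ennreal (m * urn_weight \<beta> b (mset es))"
        using nn_integral_trail_weight_powr[OF X esX[OF es], of \<delta>] \<delta>p X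
        by (simp add: P_def m_def urn_weight_def \<beta>_def b_def[abs_def] subset_eq)
    qed
    also have "\<dots> = ennreal (\<Sum>es\<in>T. m * urn_weight \<beta> b (mset es))"
    proof (rule sum_ennreal)
      fix es assume es: "es \<in> T"
      have "m \<ge> 0" unfolding m_def using \<delta>p X \<alpha>_pos d_pos
        by (intro prod_nonneg less_imp_le[OF dirichlet_moment_pos]) auto
      moreover have "urn_weight \<beta> b (mset es) \<ge> 0"
        unfolding urn_weight_def
      proof (intro divide_nonneg_nonneg less_imp_le[OF pochhammer_mset_pos])
        fix e assume "e \<in># mset es"
        then have "e \<in> V \<times> {1..d}" using T(2)[OF es] by auto
        then show "\<beta> e > 0" using \<delta>p by (auto simp: \<beta>_def)
      next
        fix x assume "x \<in># image_mset head (mset es)"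
        then have "x \<in> V" using T(2)[OF es] by auto
        then show "b x > 0" unfolding b_def using \<delta>p d_pos by (intro sum_pos) auto
      qed
      ultimately show "0 \<le> m * urn_weight \<beta> b (mset es)" by simp
    qed
    also have "\<dots> \<le> ennreal (m * \<pi>)"
    proof (intro ennreal_leI)
      have m: "m \<ge> 0" unfolding m_def using \<delta>p X \<alpha>_pos d_pos
        by (intro prod_nonneg less_imp_le[OF dirichlet_moment_pos]) auto
      have "(\<Sum>es\<in>trails z z z k L. urn_weight \<beta> b ({#} + mset es)) \<le>
        urn_weight \<beta> b {#} * (\<Prod>j<k. 1 - \<gamma> / (b z + real (count (image_mset head {#}) z) + real j))"
      proof (rule sum_urn_weight_le[OF z z \<gamma>])
        show "\<beta> (x, i) > 0" if "x \<in> V" "i \<in> {1..d}" for x i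
          using \<delta>p[OF that] by (simp add: \<beta>_def)
        show "(\<Sum>i=1..d. \<beta> (r i x, i)) = b x - (if x = z then \<gamma> else 0)" if "x \<in> V" for x
          using flow[OF that] by (simp add: \<beta>_def b_def sum.distrib)
      qed simp
      then have "(\<Sum>es\<in>T. urn_weight \<beta> b (mset es)) \<le> \<pi>"
        by (simp add: T_def \<pi>_def urn_weight_def)
      then show "(\<Sum>es\<in>T. m * urn_weight \<beta> b (mset es)) \<le> m * \<pi>"
        using m by (simp add: sum_distrib_left[symmetric] mult_left_mono)
    qed
    finally show ?thesis .
  qed
  also have "ennreal (m * \<pi>) * ennreal m' \<le> ennreal (exp (C * E) * \<pi>)"
  proof -
    have "\<pi> \<ge> 0"
    proof -
      have "0 \<le> (\<Sum>i=1..d. \<alpha> i + \<delta> (r i z) i)"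
        using \<delta>p(1) z by (intro sum_nonneg less_imp_le) auto
      then have "\<gamma> \<le> b z" using flow[OF z] by (simp add: b_def sum.distrib)
      moreover have "b z > 0" unfolding b_def using \<delta>p z d_pos by (intro sum_pos) auto
      ultimately show ?thesis unfolding \<pi>_def by (intro prod_nonneg) (auto simp: divide_le_eq)
    qed
    have "m' \<ge> 0" unfolding m'_def using \<delta>p X \<alpha>_pos d_pos
      by (intro prod_nonneg less_imp_le[OF dirichlet_moment_pos]) auto
    have "m * m' = (\<Prod>x\<in>X. dirichlet_moment d \<alpha> (\<delta> x) * dirichlet_moment d \<alpha> (\<lambda>i. - \<delta> x i))"
      by (simp add: m_def m'_def prod.distrib)
    also have "\<dots> \<le> (\<Prod>x\<in>X. exp (C * (\<Sum>i=1..d. (\<delta> x i)\<^sup>2)))"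
    proof (intro prod_mono conjI)
      fix x assume "x \<in> X"
      then have x: "x \<in> V" using X by auto
      show "0 \<le> dirichlet_moment d \<alpha> (\<delta> x) * dirichlet_moment d \<alpha> (\<lambda>i. - \<delta> x i)"
        using \<delta>p[OF x] \<alpha>_pos d_pos
        by (intro mult_nonneg_nonneg less_imp_le[OF dirichlet_moment_pos]) auto
      show "dirichlet_moment d \<alpha> (\<delta> x) * dirichlet_moment d \<alpha> (\<lambda>i. - \<delta> x i) \<le>
        exp (C * (\<Sum>i=1..d. (\<delta> x i)\<^sup>2))"
        unfolding C_def using \<delta>[OF x] \<alpha>_pos by (intro dirichlet_moment_symmetric_le d_pos) auto
    qed
    also have "\<dots> = exp (C * (\<Sum>x\<in>X. \<Sum>i=1..d. (\<delta> x i)\<^sup>2))"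
      using X by (simp add: exp_sum[symmetric] sum_distrib_left)
    also have "\<dots> \<le> exp (C * E)"
      using energy[OF X] by (auto simp: C_def intro!: mult_left_mono sum_nonneg)
    finally have "m * m' * \<pi> \<le> exp (C * E) * \<pi>"
      using \<open>\<pi> \<ge> 0\<close> by (rule mult_right_mono)
    then have "ennreal (m * \<pi> * m') \<le> ennreal (exp (C * E) * \<pi>)"
      by (intro ennreal_leI) (simp add: mult_ac)
    then show ?thesis using \<open>m' \<ge> 0\<close> by (simp add: ennreal_mult'')
  qed
  finally show ?thesis
    by (simp add: W_def C_def \<pi>_def b_def mult_right_mono)
qed

text \<open>
  The bound on the mean probability of \<open>k\<close> returns is uniform in the time horizon \<open>n\<close>, hence by
  Fatou's lemma it holds for the lower limit as \<open>n \<rightarrow> \<infinity>\<close>, and it tends to \<open>0\<close> as \<open>k \<rightarrow> \<infinity>\<close>. In an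
  environment with almost sure return, the lower limit is \<open>1\<close> for every \<open>k\<close>.
\<close>

lemma AE_not_recurrent:
  fixes \<iota> :: "nat \<Rightarrow> nat"
  assumes bij: "bij_betw \<iota> {1..d} {1..d}"
    and sym: "\<forall>i\<in>{1..d}. \<forall>x\<in>V. s (\<iota> i) x = r i x"
    and z: "z \<in> V" and F: "(\<lambda>n. visit (\<lambda>_ _. 1 / real d) z 1 n z) \<longlonglongrightarrow> F" "F < 1"
  shows "AE p in env_law. \<not> (\<lambda>n. visit p z 1 n z) \<longlonglongrightarrow> 1"
proof -
  obtain \<theta> \<gamma>\<^sub>0 where \<theta>: "\<gamma>\<^sub>0 > 0"
    "\<forall>x\<in>V. \<forall>i\<in>{1..d}. 0 \<le> \<theta> x i \<and> \<theta> x i \<le> 1"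
    "\<forall>x\<in>V. (\<Sum>i=1..d. \<theta> x i) = (\<Sum>i=1..d. \<theta> (r i x) i) + (if x = z then \<gamma>\<^sub>0 else 0)"
    "\<forall>A. finite A \<longrightarrow> A \<subseteq> V \<longrightarrow> (\<Sum>x\<in>A. \<Sum>i=1..d. (\<theta> x i)\<^sup>2) \<le> 2 * real d"
    using finite_energy_flow[OF bij sym z F] by (elim exE conjE) (rule that)
  \<comment> \<open>With this factor, \<open>\<alpha> - \<delta>\<close> stays at least \<open>\<alpha> / 2\<close>.\<close>
  define c where "c = Min (\<alpha> ` {1..d}) / 2"
  have "Min (\<alpha> ` {1..d}) \<in> \<alpha> ` {1..d}" using d_pos by (intro Min_in) auto
  then have c: "c > 0" using \<alpha>_pos by (auto simp: c_def)
  have c_le: "c \<le> \<alpha> i / 2" if "i \<in> {1..d}" for i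
    using that by (simp add: c_def)
  define \<delta> where "\<delta> x i = c * \<theta> x i" for x i
  define \<gamma> where "\<gamma> = c * \<gamma>\<^sub>0"
  define E where "E = c\<^sup>2 * (2 * real d)"
  define b where "b = (\<Sum>i=1..d. \<alpha> i + \<delta> z i)"
  define K where "K = exp ((\<Sum>i=1..d. \<bar>Polygamma 1 (\<alpha> i / 2)\<bar>) * E)"
  define \<pi> where "\<pi> k = (\<Prod>j<k. 1 - \<gamma> / (b + real j))" for k
  have \<gamma>: "\<gamma> > 0" using c \<theta>(1) by (simp add: \<gamma>_def)
  have \<delta>: "0 \<le> \<delta> x i \<and> \<delta> x i \<le> \<alpha> i / 2" if "x \<in> V" "i \<in> {1..d}" for x i
  proof -
    have *: "c * \<theta> x i \<le> c * 1" using \<theta>(2)[rule_format, OF that] c by (intro mult_left_mono) auto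
    have "0 \<le> c * \<theta> x i" using \<theta>(2)[rule_format, OF that] c by simp
    with * c_le[OF that(2)] show ?thesis unfolding \<delta>_def by linarith
  qed
  have flow: "(\<Sum>i=1..d. \<delta> x i) = (\<Sum>i=1..d. \<delta> (r i x) i) + (if x = z then \<gamma> else 0)" if "x \<in> V" for x
    using \<theta>(3)[rule_format, OF that] by (simp add: \<delta>_def \<gamma>_def sum_distrib_left[symmetric] distrib_left)
  have energy: "(\<Sum>x\<in>A. \<Sum>i=1..d. (\<delta> x i)\<^sup>2) \<le> E" if "finite A" "A \<subseteq> V" for A
  proof -
    have "(\<Sum>x\<in>A. \<Sum>i=1..d. (\<delta> x i)\<^sup>2) = c\<^sup>2 * (\<Sum>x\<in>A. \<Sum>i=1..d. (\<theta> x i)\<^sup>2)"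
      by (simp add: \<delta>_def power_mult_distrib sum_distrib_left)
    also have "\<dots> \<le> E" unfolding E_def using \<theta>(4)[rule_format, OF that] by (intro mult_left_mono) auto
    finally show ?thesis .
  qed
  have b: "b > 0" "\<gamma> \<le> b"
  proof -
    show "b > 0" unfolding b_def using \<delta>[OF z] \<alpha>_pos d_pos
      by (intro sum_pos add_pos_nonneg) auto
    have "0 \<le> (\<Sum>i=1..d. \<alpha> i + \<delta> (r i z) i)"
      using \<delta> z \<alpha>_pos by (intro sum_nonneg add_nonneg_nonneg) (auto intro: less_imp_le)
    then show "\<gamma> \<le> b" using flow[OF z] by (simp add: b_def sum.distrib)
  qed
  have \<pi>0: "\<pi> \<longlonglongrightarrow> 0"
    unfolding \<pi>_def[abs_def] by (rule prod_one_minus_tendsto_0[OF b(1) \<gamma> b(2)])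
  have \<pi>_nonneg: "\<pi> k \<ge> 0" for k
    unfolding \<pi>_def using b \<gamma> by (intro prod_nonneg) (auto simp: divide_le_eq)
  define W where "W k n p = ennreal (visit p z k n z)" for k n p
  have [measurable]: "W k n \<in> borel_measurable env_law" for k n
    unfolding W_def[abs_def] using measurable_visit[OF z] by measurable
  have int_W: "(\<integral>\<^sup>+p. W k n p \<partial>env_law) \<le> ennreal (sqrt (K * \<pi> k))" for k n
  proof -
    have sq: "(\<integral>\<^sup>+p. W k n p \<partial>env_law)\<^sup>2 \<le> ennreal (K * \<pi> k)"
      unfolding W_def K_def \<pi>_def b_def
      by (rule nn_integral_visit_squared_le[OF z less_imp_le[OF \<gamma>] \<delta> flow energy])
    show ?thesis
    proof (cases "\<integral>\<^sup>+p. W k n p \<partial>env_law")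
      case (real y)
      then have "y\<^sup>2 \<le> K * \<pi> k"
        using sq \<pi>_nonneg by (simp add: ennreal_power K_def)
      then have "y \<le> sqrt (K * \<pi> k)" by (rule real_le_rsqrt)
      then show ?thesis unfolding real(2) by (rule ennreal_leI)
    next
      case top
      then show ?thesis using sq by (simp add: power2_eq_square ennreal_top_mult top_unique)
    qed
  qed
  \<comment> \<open>The infimum over \<open>k\<close> turns the bounds for all \<open>k\<close> into one null function.\<close>
  define g where "g p = (INF k. liminf (\<lambda>n. W k n p))" for p
  have [measurable]: "g \<in> borel_measurable env_law"
    unfolding g_def[abs_def] by measurable
  have int_g: "(\<integral>\<^sup>+p. g p \<partial>env_law) \<le> ennreal (sqrt (K * \<pi> k))" for k
  proof -
    have "(\<integral>\<^sup>+p. g p \<partial>env_law) \<le> (\<integral>\<^sup>+p. liminf (\<lambda>n. W k n p) \<partial>env_law)"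
      unfolding g_def by (intro nn_integral_mono INF_lower) auto
    also have "\<dots> \<le> liminf (\<lambda>n. \<integral>\<^sup>+p. W k n p \<partial>env_law)"
      by (rule nn_integral_liminf) measurable
    also have "\<dots> \<le> liminf (\<lambda>n. ennreal (sqrt (K * \<pi> k)))"
      using int_W by (intro Liminf_mono always_eventually) auto
    finally show ?thesis by (simp add: Liminf_const)
  qed
  have "(\<lambda>k. ennreal (sqrt (K * \<pi> k))) \<longlonglongrightarrow> ennreal (sqrt (K * 0))"
    by (intro tendsto_ennrealI tendsto_real_sqrt tendsto_mult tendsto_const \<pi>0)
  then have "(\<integral>\<^sup>+p. g p \<partial>env_law) \<le> 0"
    using int_g by (intro LIMSEQ_le_const[where X = "\<lambda>k. ennreal (sqrt (K * \<pi> k))"]) auto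
  then have "AE p in env_law. g p = 0"
    by (simp add: nn_integral_0_iff_AE)
  with AE_env_law show ?thesis
  proof eventually_elim
    case (elim p)
    have env: "environment p" using elim(1) by (auto simp: environment_def intro: less_imp_le)
    show ?case
    proof
      assume lim: "(\<lambda>n. visit p z 1 n z) \<longlonglongrightarrow> 1"
      have "liminf (\<lambda>n. W k n p) = 1" for k
      proof (rule lim_imp_Liminf)
        show "(\<lambda>n. W k n p) \<longlonglongrightarrow> 1"
          unfolding W_def using tendsto_ennrealI[OF visit_tendsto_1[OF env z lim, of k]] by simp
      qed simp
      then show False using elim(2) by (simp add: g_def)
    qed
  qed
qed

end

section \<open>Cayley graphs\<close>

text \<open>
  As \<open>S\<close> is symmetric, the generated subgroup consists of the products of lists over \<open>S\<close>.
\<close>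

lemma countable_generate:
  assumes G: "group G" and S: "countable S" "S \<subseteq> carrier G" "\<And>x. x \<in> S \<Longrightarrow> inv\<^bsub>G\<^esub> x \<in> S"
  shows "countable (generate G S)"
proof -
  interpret group G by fact
  define w where "w = (\<lambda>xs. foldr (\<lambda>x y. x \<otimes>\<^bsub>G\<^esub> y) xs \<one>\<^bsub>G\<^esub>)"
  have w_in: "w xs \<in> carrier G" if "set xs \<subseteq> S" for xs
    using that S(2) by (induction xs) (auto simp: w_def)
  have w_append: "w (xs @ ys) = w xs \<otimes>\<^bsub>G\<^esub> w ys" if "set xs \<subseteq> S" "set ys \<subseteq> S" for xs ys
    using that(1)
  proof (induction xs)
    case Nil
    then show ?case using w_in[OF that(2)] by (simp add: w_def)
  next
    case (Cons x xs)
    then have "x \<in> carrier G" "w xs \<in> carrier G" using S(2) w_in by auto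
    with Cons w_in[OF that(2)] show ?case by (simp add: w_def m_assoc)
  qed
  have single: "x = w [x]" if "x \<in> S" for x using that S(2) by (auto simp: w_def)
  have "generate G S \<subseteq> w ` lists S"
  proof
    fix x assume "x \<in> generate G S"
    then show "x \<in> w ` lists S"
    proof induction
      case one
      have "w [] = \<one>\<^bsub>G\<^esub>" by (simp add: w_def)
      then show ?case by (metis imageI lists.Nil)
    next
      case (incl h)
      then show ?case using single[of h] by (intro image_eqI[of _ _ "[h]"]) auto
    next
      case (inv h)
      then show ?case using single[OF S(3)] S(3) by (intro image_eqI[of _ _ "[inv\<^bsub>G\<^esub> h]"]) auto
    next
      case (eng h1 h2)
      then obtain xs ys where "set xs \<subseteq> S" "h1 = w xs" "set ys \<subseteq> S" "h2 = w ys"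
        by (auto simp: lists_eq_set)
      then show ?case using w_append[of xs ys] by (intro image_eqI[of _ _ "xs @ ys"]) (auto simp: lists_eq_set)
    qed
  qed
  then show ?thesis
    by (rule countable_subset) (intro countable_image countable_lists S(1))
qed

lemma simple_walk_step:
  assumes "x \<in> carrier G" "d \<ge> 1" "inj_on (\<lambda>i. x \<otimes>\<^bsub>G\<^esub> e i) {1..d}" "i \<in> {1..d}"
  shows "pmf (simple_walk (cayley_edges G (e ` {1..d})) x) (x \<otimes>\<^bsub>G\<^esub> e i) = 1 / real d"
proof -
  have "cayley_edges G (e ` {1..d}) `` {x} = (\<lambda>i. x \<otimes>\<^bsub>G\<^esub> e i) ` {1..d}"
    using assms(1) by (auto simp: cayley_edges_def)
  moreover have "card ((\<lambda>i. x \<otimes>\<^bsub>G\<^esub> e i) ` {1..d}) = d"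
    using card_image[OF assms(3)] by simp
  moreover have "{1..d} \<noteq> {}" using assms(2) by simp
  ultimately show ?thesis
    using assms(4) unfolding simple_walk_def by (subst pmf_of_set) auto
qed

text \<open>
  Positivity of the jump probabilities makes the support of the step law equal to \<open>{1..d}\<close>, the set on
  which the labels are determined by the jumps.
\<close>

lemma env_walk_step:
  assumes inj: "inj_on (\<lambda>i. x \<otimes>\<^bsub>G\<^esub> e i) {1..d}" and i: "i \<in> {1..d}"
    and p: "\<And>i. i \<in> {1..d} \<Longrightarrow> 0 < p x i" "(\<Sum>i=1..d. p x i) = 1"
  shows "pmf (env_walk G d e p x) (x \<otimes>\<^bsub>G\<^esub> e i) = p x i"
proof -
  define f where "f i = (if i \<in> {1..d} then p x i else 0)" for i
  have f: "f i \<ge> 0" for i using p(1) by (auto simp: f_def intro: less_imp_le)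
  have "(\<integral>\<^sup>+i. ennreal (f i) \<partial>count_space UNIV) = (\<Sum>i=1..d. ennreal (f i))"
    by (intro nn_integral_count_space') (auto simp: f_def)
  also have "\<dots> = ennreal (\<Sum>i=1..d. f i)" using f by (intro sum_ennreal)
  also have "(\<Sum>i=1..d. f i) = 1" using p(2) by (simp add: f_def)
  finally have Q: "pmf (embed_pmf f) i = f i" for i
    by (intro pmf_embed_pmf f) simp
  have set: "set_pmf (embed_pmf f) = {1..d}"
  proof (rule Set.set_eqI)
    fix i show "i \<in> set_pmf (embed_pmf f) \<longleftrightarrow> i \<in> {1..d}"
      using p(1)[of i] unfolding set_pmf_iff Q f_def by (cases "i \<in> {1..d}") auto
  qed
  have "env_walk G d e p x = map_pmf (\<lambda>i. x \<otimes>\<^bsub>G\<^esub> e i) (embed_pmf f)"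
    by (simp add: env_walk_def f_def[abs_def])
  then show ?thesis
    using pmf_map_inj[of "\<lambda>i. x \<otimes>\<^bsub>G\<^esub> e i" "embed_pmf f" i] inj i by (simp add: set Q f_def)
qed

theorem corollary1:
  fixes G :: "('a, 'b) monoid_scheme" and d :: nat and e :: "nat \<Rightarrow> 'a" and \<alpha> :: "nat \<Rightarrow> real"
  assumes "group G"
    and "d \<ge> 1"
    and "e ` {1..d} \<subseteq> carrier G"
    and "inj_on e {1..d}"
    and "\<And>s. s \<in> e ` {1..d} \<Longrightarrow> inv\<^bsub>G\<^esub> s \<in> e ` {1..d}"
    and "generate G (e ` {1..d}) = carrier G"
    and "\<And>i. i \<in> {1..d} \<Longrightarrow> \<alpha> i > 0"
    and "transient (carrier G) (simple_walk (cayley_edges G (e ` {1..d})))"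
  shows "AE p in dirichlet_env G d \<alpha>. transient (carrier G) (env_walk G d e p)"
proof -
  interpret group G by fact
  have e_in: "e i \<in> carrier G" if "i \<in> {1..d}" for i
    using assms(3) that by auto
  have count: "countable (carrier G)"
    using countable_generate[OF assms(1) _ assms(3,5)] assms(6) by auto
  interpret dirichlet_digraph "carrier G" d "\<lambda>i x. x \<otimes>\<^bsub>G\<^esub> e i" "\<lambda>i x. x \<otimes>\<^bsub>G\<^esub> inv\<^bsub>G\<^esub> e i" \<alpha>
  proof
    show "inj_on (\<lambda>i. x \<otimes>\<^bsub>G\<^esub> e i) {1..d}" if "x \<in> carrier G" for x
    proof (rule inj_onI)
      fix i j assume ij: "i \<in> {1..d}" "j \<in> {1..d}" "x \<otimes>\<^bsub>G\<^esub> e i = x \<otimes>\<^bsub>G\<^esub> e j"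
      then have "e i = e j" using that e_in Units_l_cancel[of x] Units_eq by simp
      then show "i = j" using assms(4) ij by (auto dest: inj_onD)
    qed
  qed (use assms(2,7) count e_in in \<open>auto simp: m_assoc\<close>)
  have "\<forall>i\<in>{1..d}. \<exists>j\<in>{1..d}. e j = inv\<^bsub>G\<^esub> e i" using assms(5) by force
  then obtain \<iota> where \<iota>: "\<And>i. i \<in> {1..d} \<Longrightarrow> \<iota> i \<in> {1..d} \<and> e (\<iota> i) = inv\<^bsub>G\<^esub> e i" by metis
  have "inj_on \<iota> {1..d}"
  proof (rule inj_onI)
    fix i j assume ij: "i \<in> {1..d}" "j \<in> {1..d}" "\<iota> i = \<iota> j"
    then have "inv\<^bsub>G\<^esub> e i = inv\<^bsub>G\<^esub> e j" using \<iota> by metis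
    then have "e i = e j" using e_in ij by (metis inv_inv)
    then show "i = j" using assms(4) ij by (auto dest: inj_onD)
  qed
  then have bij: "bij_betw \<iota> {1..d} {1..d}"
    unfolding bij_betw_def using \<iota> by (intro conjI endo_inj_surj) auto
  have no_return: "AE p in env_law. \<not> (\<lambda>n. visit p z 1 n z) \<longlonglongrightarrow> 1" if z: "z \<in> carrier G" for z
  proof (rule AE_not_recurrent[OF bij _ z])
    show "\<forall>i\<in>{1..d}. \<forall>x\<in>carrier G. x \<otimes>\<^bsub>G\<^esub> e (\<iota> i) = x \<otimes>\<^bsub>G\<^esub> inv\<^bsub>G\<^esub> e i"
      using \<iota> by simp
    let ?K = "simple_walk (cayley_edges G (e ` {1..d}))"
    show "(\<lambda>n. visit (\<lambda>_ _. 1 / real d) z 1 n z) \<longlonglongrightarrow> measure (markov_law ?K z) {\<omega>. \<exists>n\<ge>1. \<omega> n = z}"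
      using assms(2) s_inj by (intro visit_tendsto_return_probability z simple_walk_step)
        (auto simp: environment_def)
    show "measure (markov_law ?K z) {\<omega>. \<exists>n\<ge>1. \<omega> n = z} < 1"
      using assms(8) z by (auto simp: transient_def)
  qed
  have "AE p in env_law. \<forall>z\<in>carrier G. \<not> (\<lambda>n. visit p z 1 n z) \<longlonglongrightarrow> 1"
    by (rule AE_ball_countable'[OF no_return count])
  with AE_env_law have "AE p in env_law. transient (carrier G) (env_walk G d e p)"
  proof eventually_elim
    case (elim p)
    have env: "environment p" using elim(1) by (auto simp: environment_def intro: less_imp_le)
    show ?case unfolding transient_def
    proof
      fix z assume z: "z \<in> carrier G"
      let ?m = "measure (markov_law (env_walk G d e p) z) {\<omega>. \<exists>n\<ge>1. \<omega> n = z}"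
      have "(\<lambda>n. visit p z 1 n z) \<longlonglongrightarrow> ?m"
        using elim(1) by (intro visit_tendsto_return_probability env z env_walk_step s_inj) auto
      then have "?m \<noteq> 1" using elim(2) z by metis
      moreover have "?m \<le> 1" by (rule prob_space.prob_le_1[OF prob_space_markov_law])
      ultimately show "?m < 1" by linarith
    qed
  qed
  then show ?thesis unfolding dirichlet_env_def .
qed

end
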